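(* Let $V$ be an $n$-dimensional vector space over a field $\mathbb{K}$, and let $\ast:\Lambda(V)\to\Lambda(V)$ be the Hodge star operator associated to an ordered basis $(f_1,\dots,f_n)$ of $V$. Then for all extensors $A$ and $B$ in $\Lambda(V)$ of steps $a$ and $b$, respectively, and every positive integer $h$, $$(\ast\otimes\ast)\,\diamond_{21}^{(h)}(A\otimes B)=(-1)^{h(a+b-n)}\,\diamond_{12}^{(h)}\,(\ast\otimes\ast)(A\otimes B).$$
   Context: $\Lambda(V)$ is the exterior algebra of $V$; its product is written by juxtaposition. An extensor of step $k$ is an element of $\Lambda(V)$ that can be written as a product $v_1v_2\cdots v_k$ of $k$ vectors of $V$ (for $k=0$: a scalar). For $A=v_1\cdots v_a$ and integers $i,j\ge 0$ with $i+j=a$, the coproduct slice is $$\sum_{(A)_{(i,j)}}A_{(1)}\otimes A_{(2)}=\sum_{I}\operatorname{sgn}(I,J)\;v_I\otimes v_J,$$ where $I$ runs over the $i$-element subsets of $\{1,\dots,a\}$, $J$ is the complement of $I$, $v_I$ and $v_J$ are the products of the corresponding vectors in increasing order of index, and $\operatorname{sgn}(I,J)$ is the sign of the permutation listing $I$ increasingly followed by $J$ increasingly. It is the $(i,j)$-homogeneous component of the usual coproduct of $\Lambda(V)$. If $i<0$ or $j<0$ the slice is $0$. The geometric products $\diamond^{(h)}_{21},\diamond^{(h)}_{12}:\Lambda(V)\otimes\Lambda(V)\to\Lambda(V)\otimes\Lambda(V)$ are the linear operators defined, for extensors $A,B$ of steps $a,b$, by $$\diamond^{(h)}_{21}(A\otimes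 B)=\sum_{(A)_{(a-h,h)}}A_{(1)}\otimes A_{(2)}B,\qquad \diamond^{(h)}_{12}(A\otimes B)=\sum_{(B)_{(h,b-h)}}AB_{(1)}\otimes B_{(2)}.$$ Hodge star operator: for a subset $I=\{i_1<\dots<i_k\}$ of $\{1,\dots,n\}$ put $f_I=f_{i_1}\cdots f_{i_k}$ (with $f_\emptyset=1$) and $F=f_1\cdots f_n$. The Hodge star operator associated to $(f_1,\dots,f_n)$ is the linear operator $\ast$ on $\Lambda(V)$ with $\ast f_I=\epsilon_I f_{I'}$, where $I'$ is the complement of $I$ in $\{1,\dots,n\}$ and $\epsilon_I\in\{1,-1\}$ is the sign defined by $F=\epsilon_I f_I f_{I'}$. The operator $\ast\otimes\ast$ on $\Lambda(V)\otimes\Lambda(V)$ is the plain tensor product, $(\ast\otimes\ast)(X\otimes Y)=(\ast X)\otimes(\ast Y)$, with no additional sign. *)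

theory Defs
  imports
    Main
    "HOL.Vector_Spaces"
    "HOL-Library.Poly_Mapping"
    "HOL-Combinatorics.Permutations"
begin

section \<open>Vector spaces given by generators and relations\<close>

text \<open>The type \<open>'x \<Rightarrow>\<^sub>0 'k\<close> is the free vector space over \<open>'k\<close> on the set of all elements of \<open>'x\<close>,
  with basis vectors \<open>Poly_Mapping.single x 1\<close>.\<close>

definition free_scale :: "'k::field \<Rightarrow> ('x \<Rightarrow>\<^sub>0 'k) \<Rightarrow> ('x \<Rightarrow>\<^sub>0 'k)" where
  "free_scale c p = Poly_Mapping.map (\<lambda>x. c * x) p"

definition free_extend ::
  "('k::field \<Rightarrow> 'e::ab_group_add \<Rightarrow> 'e) \<Rightarrow> ('x \<Rightarrow> 'e) \<Rightarrow> ('x \<Rightarrow>\<^sub>0 'k) \<Rightarrow> 'e" where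
  "free_extend s g p = (\<Sum>x\<in>Poly_Mapping.keys p. s (Poly_Mapping.lookup p x) (g x))"

text \<open>\<open>presented_by s g R\<close>: the linear extension of \<open>g\<close> induces an isomorphism from the quotient
  of the free vector space on \<open>'x\<close> by the span of \<open>R\<close> onto the whole space \<open>'e\<close>.\<close>

definition presented_by ::
  "('k::field \<Rightarrow> 'e::ab_group_add \<Rightarrow> 'e) \<Rightarrow> ('x \<Rightarrow> 'e) \<Rightarrow> ('x \<Rightarrow>\<^sub>0 'k) set \<Rightarrow> bool" where
  "presented_by s g R \<longleftrightarrow>
     surj (free_extend s g) \<and> {p. free_extend s g p = 0} = module.span free_scale R"


section \<open>Tensor products\<close>

definition tensor_relations ::
  "('k::field \<Rightarrow> 'a::ab_group_add \<Rightarrow> 'a) \<Rightarrow> ('k \<Rightarrow> 'b::ab_group_add \<Rightarrow> 'b) \<Rightarrow> ('a \<times> 'b \<Rightarrow>\<^sub>0 'k) set" where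
  "tensor_relations sA sB =
     {Poly_Mapping.single (x + x', y) 1 - Poly_Mapping.single (x, y) 1 - Poly_Mapping.single (x', y) 1
        | x x' y. True} \<union>
     {Poly_Mapping.single (x, y + y') 1 - Poly_Mapping.single (x, y) 1 - Poly_Mapping.single (x, y') 1
        | x y y'. True} \<union>
     {Poly_Mapping.single (sA c x, y) 1 - Poly_Mapping.single (x, y) c | c x y. True} \<union>
     {Poly_Mapping.single (x, sB c y) 1 - Poly_Mapping.single (x, y) c | c x y. True}"

text \<open>The space \<open>'t\<close> with pure tensors \<open>tens x y\<close> is the tensor product of \<open>'a\<close> and \<open>'b\<close>: the free
  vector space on \<open>'a \<times> 'b\<close> modulo the bilinearity relations.\<close>

definition is_tensor_product ::
  "('k::field \<Rightarrow> 'a::ab_group_add \<Rightarrow> 'a) \<Rightarrow> ('k \<Rightarrow> 'b::ab_group_add \<Rightarrow> 'b) \<Rightarrow>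
   ('k \<Rightarrow> 't::ab_group_add \<Rightarrow> 't) \<Rightarrow> ('a \<Rightarrow> 'b \<Rightarrow> 't) \<Rightarrow> bool" where
  "is_tensor_product sA sB sT tens \<longleftrightarrow>
     vector_space sA \<and> vector_space sB \<and> vector_space sT \<and>
     presented_by sT (\<lambda>(x, y). tens x y) (tensor_relations sA sB)"

text \<open>The plain (unsigned) tensor product of two linear operators.\<close>

definition tensor_map ::
  "('k::field \<Rightarrow> 't::ab_group_add \<Rightarrow> 't) \<Rightarrow> ('a \<Rightarrow> 'a \<Rightarrow> 't) \<Rightarrow> ('a \<Rightarrow> 'a) \<Rightarrow> ('a \<Rightarrow> 'a) \<Rightarrow> 't \<Rightarrow> 't" where
  "tensor_map sT tens f g =
     (THE L. Vector_Spaces.linear sT sT L \<and> (\<forall>x y. L (tens x y) = tens (f x) (g y)))"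


section \<open>Exterior algebra\<close>

text \<open>A word \<open>[v\<^sub>1, \<dots>, v\<^sub>k]\<close> stands for the tensor \<open>v\<^sub>1 \<otimes> \<dots> \<otimes> v\<^sub>k\<close>. The first two families of
  relations cut the free vector space on words down to the tensor algebra of \<open>V\<close>; the third one
  spans, modulo these, the two-sided ideal generated by the squares \<open>v \<otimes> v\<close>.\<close>

definition exterior_relations ::
  "('k::field \<Rightarrow> 'v::ab_group_add \<Rightarrow> 'v) \<Rightarrow> ('v list \<Rightarrow>\<^sub>0 'k) set" where
  "exterior_relations sV =
     {Poly_Mapping.single (us @ (v + v') # ws) 1 - Poly_Mapping.single (us @ v # ws) 1
        - Poly_Mapping.single (us @ v' # ws) 1 | us v v' ws. True} \<union>
     {Poly_Mapping.single (us @ sV c v # ws) 1 - Poly_Mapping.single (us @ v # ws) c | us c v ws. True} \<union>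
     {Poly_Mapping.single (us @ v # v # ws) 1 | us v ws. True}"

definition ext_prod :: "('v \<Rightarrow> 'e::ring_1) \<Rightarrow> 'v list \<Rightarrow> 'e" where
  "ext_prod \<iota> vs = prod_list (map \<iota> vs)"

text \<open>The \<open>'k\<close>-algebra \<open>'e\<close>, together with \<open>\<iota> :: 'v \<Rightarrow> 'e\<close>, is the exterior algebra of \<open>'v\<close>: the tensor
  algebra modulo the ideal generated by all squares of vectors. Linearity of \<open>\<iota>\<close> and
  \<open>\<iota> v * \<iota> v = 0\<close> are part of the presentation.\<close>

definition is_exterior_algebra ::
  "('k::field \<Rightarrow> 'v::ab_group_add \<Rightarrow> 'v) \<Rightarrow> ('k \<Rightarrow> 'e::ring_1 \<Rightarrow> 'e) \<Rightarrow> ('v \<Rightarrow> 'e) \<Rightarrow> bool" where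
  "is_exterior_algebra sV sE \<iota> \<longleftrightarrow>
     vector_space sV \<and> vector_space sE \<and>
     (\<forall>c x y. sE c (x * y) = sE c x * y \<and> sE c (x * y) = x * sE c y) \<and>
     presented_by sE (ext_prod \<iota>) (exterior_relations sV)"

definition is_extensor ::
  "('k::field \<Rightarrow> 'e::ring_1 \<Rightarrow> 'e) \<Rightarrow> ('v \<Rightarrow> 'e) \<Rightarrow> nat \<Rightarrow> 'e \<Rightarrow> bool" where
  "is_extensor sE \<iota> k A \<longleftrightarrow>
     (if k = 0 then \<exists>c. A = sE c 1 else \<exists>vs. length vs = k \<and> A = ext_prod \<iota> vs)"


section \<open>Coproduct slices and geometric products\<close>

text \<open>Positions in lists are counted from \<open>0\<close>, so \<open>{1, \<dots>, a}\<close> becomes \<open>{..<a}\<close>. The sign is that of the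
  permutation of \<open>{..<a}\<close> listing \<open>I\<close> increasingly and then its complement increasingly.\<close>

definition split_sign :: "nat \<Rightarrow> nat set \<Rightarrow> int" where
  "split_sign a I =
     sign (\<lambda>k. if k < a then (sorted_list_of_set I @ sorted_list_of_set ({..<a} - I)) ! k else k)"

text \<open>Sweedler sum over the \<open>(i,j)\<close>-slice of \<open>A = v\<^sub>1 \<cdots> v\<^sub>a\<close>: the sum of \<open>g A\<^sub>1 A\<^sub>2\<close>, where
  \<open>g\<close> is any bilinear expression; for \<open>g = tens\<close> it is the slice itself. For \<open>i < 0\<close>, \<open>j < 0\<close>
  or \<open>i + j \<noteq> a\<close> the index set is empty. Note that \<open>nths vs I\<close> is the sublist of \<open>vs\<close> at the
  positions in \<open>I\<close>, in increasing order.\<close>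

definition slice_sum ::
  "('k::field \<Rightarrow> 't::ab_group_add \<Rightarrow> 't) \<Rightarrow> ('v \<Rightarrow> 'e::ring_1) \<Rightarrow> 'v list \<Rightarrow> int \<Rightarrow> int \<Rightarrow>
   ('e \<Rightarrow> 'e \<Rightarrow> 't) \<Rightarrow> 't" where
  "slice_sum sT \<iota> vs i j g =
     (\<Sum>I \<in> {I. I \<subseteq> {..<length vs} \<and> int (card I) = i \<and> int (card ({..<length vs} - I)) = j}.
        sT (of_int (split_sign (length vs) I))
           (g (ext_prod \<iota> (nths vs I)) (ext_prod \<iota> (nths vs ({..<length vs} - I)))))"

text \<open>In the next two definitions extensors of step \<open>0\<close> are represented by \<open>ext_prod \<iota> [] = 1\<close>
  only; other scalars are covered by linearity.\<close>

definition diamond21 ::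
  "('k::field \<Rightarrow> 't::ab_group_add \<Rightarrow> 't) \<Rightarrow> ('e::ring_1 \<Rightarrow> 'e \<Rightarrow> 't) \<Rightarrow> ('v \<Rightarrow> 'e) \<Rightarrow> nat \<Rightarrow> 't \<Rightarrow> 't" where
  "diamond21 sT tens \<iota> h =
     (THE D. Vector_Spaces.linear sT sT D \<and>
        (\<forall>vs ws. D (tens (ext_prod \<iota> vs) (ext_prod \<iota> ws)) =
           slice_sum sT \<iota> vs (int (length vs) - int h) (int h)
             (\<lambda>A1 A2. tens A1 (A2 * ext_prod \<iota> ws))))"

definition diamond12 ::
  "('k::field \<Rightarrow> 't::ab_group_add \<Rightarrow> 't) \<Rightarrow> ('e::ring_1 \<Rightarrow> 'e \<Rightarrow> 't) \<Rightarrow> ('v \<Rightarrow> 'e) \<Rightarrow> nat \<Rightarrow> 't \<Rightarrow> 't" where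
  "diamond12 sT tens \<iota> h =
     (THE D. Vector_Spaces.linear sT sT D \<and>
        (\<forall>vs ws. D (tens (ext_prod \<iota> vs) (ext_prod \<iota> ws)) =
           slice_sum sT \<iota> ws (int h) (int (length ws) - int h)
             (\<lambda>B1 B2. tens (ext_prod \<iota> vs * B1) B2)))"


section \<open>Hodge star\<close>

definition is_ordered_basis ::
  "('k::field \<Rightarrow> 'v::ab_group_add \<Rightarrow> 'v) \<Rightarrow> 'v list \<Rightarrow> bool" where
  "is_ordered_basis sV fs \<longleftrightarrow>
     distinct fs \<and> \<not> module.dependent sV (set fs) \<and> module.span sV (set fs) = UNIV"

text \<open>Here \<open>ext_prod \<iota> (nths fs I)\<close> is \<open>f\<^sub>I\<close> and \<open>ext_prod \<iota> fs\<close> is \<open>F\<close>.\<close>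

definition hodge_star ::
  "('k::field \<Rightarrow> 'e::ring_1 \<Rightarrow> 'e) \<Rightarrow> ('v \<Rightarrow> 'e) \<Rightarrow> 'v list \<Rightarrow> 'e \<Rightarrow> 'e" where
  "hodge_star sE \<iota> fs =
     (THE L. Vector_Spaces.linear sE sE L \<and>
        (\<forall>I \<subseteq> {..<length fs}. \<exists>\<epsilon> \<in> {1, -1}.
           ext_prod \<iota> fs =
             sE \<epsilon> (ext_prod \<iota> (nths fs I) * ext_prod \<iota> (nths fs ({..<length fs} - I))) \<and>
           L (ext_prod \<iota> (nths fs I)) = sE \<epsilon> (ext_prod \<iota> (nths fs ({..<length fs} - I)))))"

end

theory Submission
  imports Defs
begin

text \<open>
Let \<open>F = f\<^sub>1 \<cdots> f\<^sub>n\<close>. Declaring the basis orthonormal gives a symmetric bilinear form \<open>\<beta>\<close> on \<open>V\<close>, and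
every vector \<open>v\<close> then acts on \<open>\<Lambda>(V)\<close> by contraction: the antiderivation \<open>i\<^sub>v\<close> with
\<open>i\<^sub>v(w) = \<beta> v w\<close>. The Hodge star is the operator that contracts into \<open>F\<close>
(\<open>hodge_star_eq_dual\<close>): it satisfies \<open>\<ast>1 = F\<close> and \<open>\<ast>(xv) = i\<^sub>v(\<ast>x)\<close>, and these two
equations, together with \<open>Fv = 0\<close> and the grade of \<open>F\<close>, are all that the duality uses. So the proof never
compares signs of subsets of the basis.

Since \<open>A\<^sub>2 B = (-1)\<^sup>h\<^sup>b B A\<^sub>2\<close> for \<open>A\<^sub>2\<close> of step \<open>h\<close>, the theorem reduces to

  \<open>\<Sum> \<ast>A\<^sub>1 \<otimes> \<ast>(B A\<^sub>2) = (-1)\<^bsup>h(a-n)\<^esup> \<Sum> (\<ast>A)(\<ast>B)\<^sub>1 \<otimes> (\<ast>B)\<^sub>2\<close>,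

where \<open>A\<^sub>2\<close> on the left and \<open>(\<ast>B)\<^sub>1\<close> on the right have step \<open>h\<close>.
This is \<open>slice_sum_dual\<close>. It is proved by induction on \<open>A\<close>, appending one vector \<open>v\<close> at a time. For
\<open>A = 1\<close> the right-hand side involves \<open>F (\<ast>B)\<^sub>1\<close>, which vanishes unless \<open>h = 0\<close>, because \<open>F\<close> is
annihilated by every vector. On the left the slice of \<open>Av\<close> splits according to the factor that
receives \<open>v\<close> (\<open>slice_sum_snoc\<close>), and \<open>v\<close> becomes a contraction of the first or the second tensor factor. On
the right \<open>\<ast>(Av) = i\<^sub>v(\<ast>A)\<close>, and the same two contractions appear by a Leibniz rule for the product
\<open>X \<otimes> Y \<mapsto> \<Sum> X Y\<^sub>1 \<otimes> Y\<^sub>2\<close> (\<open>left_merge_contract\<close>). That rule combines the antiderivation property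
of \<open>i\<^sub>v\<close> with the fact that contracting the first factor of a coproduct slice is, up to sign, contracting
the second factor of the neighbouring slice (\<open>slice_sum_contract\<close>).

The geometric products, the star and \<open>\<ast> \<otimes> \<ast>\<close> are given by descriptions, so each must be shown to
exist and to be unique. Existence comes from the universal properties of the presentations
(\<open>exterior_lift\<close>, \<open>tensor_lift\<close>), which reduce it to multilinearity and alternation on words; for
coproduct slices these follow from the recursion \<open>slice_sum_Cons\<close>. Uniqueness comes from spanning
sets; for the star it also needs \<open>F \<noteq> 0\<close>, which holds because contracting \<open>F\<close> with
\<open>f\<^sub>1, \<dots>, f\<^sub>n\<close> in turn yields \<open>1\<close>, and \<open>1 \<noteq> 0\<close>.
\<close>

section \<open>Signs of splittings\<close>

text \<open>One-line notation: the list is the sequence of values on an initial segment, and the map is the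
identity beyond it.\<close>

definition listing :: "nat list \<Rightarrow> nat \<Rightarrow> nat" where
  "listing xs k = (if k < length xs then xs ! k else k)"

lemma listing_permutes:
  assumes "distinct xs" "set xs = {..<length xs}"
  shows "listing xs permutes {..<length xs}"
proof (rule bij_imp_permutes)
  have "bij_betw ((!) xs) {..<length xs} (set xs)"
    using assms(1) by (rule bij_betw_nth) auto
  then show "bij_betw (listing xs) {..<length xs} {..<length xs}"
    unfolding assms(2) by (rule bij_betw_cong[THEN iffD1, rotated]) (simp add: listing_def)
qed (simp add: listing_def)

lemma sign_listing_shift:
  assumes "distinct xs" "set xs = {..<length xs}"
  shows "sign (listing (0 # map Suc xs)) = sign (listing xs)"
proof -
  have "listing (0 # map Suc xs) = map_permutation {..<length xs} Suc (listing xs)"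
  proof
    fix k
    show "listing (0 # map Suc xs) k = map_permutation {..<length xs} Suc (listing xs) k"
    proof (cases k)
      case (Suc m)
      then show ?thesis
      proof (cases "m < length xs")
        case True
        have "inv_into {..<length xs} Suc (Suc m) = m"
          by (rule inv_into_f_f) (use True in auto)
        with True Suc show ?thesis
          by (auto simp: listing_def map_permutation_def restrict_id_def image_iff)
      qed (use Suc in \<open>auto simp: listing_def map_permutation_def restrict_id_def\<close>)
    qed (auto simp: listing_def map_permutation_def restrict_id_def)
  qed
  then show ?thesis
    using sign_map_permutation[of Suc, OF _ listing_permutes[OF assms]] by simp
qed

lemma sign_listing_swap:
  assumes "distinct (us @ x # y # ws)" "set (us @ x # y # ws) = {..<length (us @ x # y # ws)}"
  shows "sign (listing (us @ y # x # ws)) = - sign (listing (us @ x # y # ws))"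
proof -
  let ?k = "length us"
  \<comment> \<open>Exchanging two neighbouring values is composing with a transposition of their positions.\<close>
  have "listing (us @ y # x # ws) = listing (us @ x # y # ws) \<circ> transpose ?k (Suc ?k)"
    by (rule ext) (auto simp: listing_def transpose_def nth_append nth_Cons split: nat.splits)
  moreover have "permutation (listing (us @ x # y # ws))"
    using listing_permutes[OF assms] permutation_permutes by blast
  ultimately show ?thesis
    by (simp add: sign_compose sign_swap_id permutation_swap_id)
qed

text \<open>Moving an entry to the front takes one adjacent transposition for each entry it passes.\<close>

lemma sign_listing_move:
  assumes "distinct (us @ x # ws)" "set (us @ x # ws) = {..<length (us @ x # ws)}"
  shows "sign (listing (us @ x # ws)) = (- 1) ^ length us * sign (listing (x # us @ ws))"
  using assms
proof (induction us arbitrary: ws rule: rev_induct)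
  case (snoc u us)
  have "sign (listing (us @ u # x # ws)) = - sign (listing (us @ x # u # ws))"
    by (rule sign_listing_swap) (use snoc.prems in auto)
  also have "sign (listing (us @ x # u # ws)) = (- 1) ^ length us * sign (listing (x # us @ u # ws))"
    by (rule snoc.IH) (use snoc.prems in auto)
  finally show ?case by simp
qed simp

lemma split_sign_listing:
  assumes "I \<subseteq> {..<a}"
  shows "split_sign a I = sign (listing (sorted_list_of_set I @ sorted_list_of_set ({..<a} - I)))"
proof -
  have "finite I" using assms finite_subset by blast
  moreover have "card I + card ({..<a} - I) = a"
    using assms \<open>finite I\<close> by (simp add: card_Diff_subset card_mono[of "{..<a}", simplified])
  ultimately show ?thesis
    by (simp add: split_sign_def listing_def[abs_def])
qed

lemma sorted_list_of_set_Suc_image: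
  "finite I \<Longrightarrow> sorted_list_of_set (Suc ` I) = map Suc (sorted_list_of_set I)"
  by (intro sorted_list_of_set.sorted_key_list_of_set_unique[THEN iffD1])
     (auto simp: sorted_wrt_map distinct_map card_image strict_sorted_iff)

lemma split_listing_props:
  assumes "I \<subseteq> {..<a}"
  defines "xs \<equiv> sorted_list_of_set I" and "ys \<equiv> sorted_list_of_set ({..<a} - I)"
  shows "distinct (xs @ ys)" "set (xs @ ys) = {..<length (xs @ ys)}" "length xs = card I"
proof -
  have "finite I" using assms finite_subset by blast
  moreover have "card I + card ({..<a} - I) = a"
    using assms \<open>finite I\<close> by (simp add: card_Diff_subset card_mono[of "{..<a}", simplified])
  ultimately show "distinct (xs @ ys)" "set (xs @ ys) = {..<length (xs @ ys)}" "length xs = card I"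
    using assms by auto
qed

text \<open>This and the next lemma let the sign of a splitting be computed by recursion on the word: the first
letter either joins the left block, where it is already in place, or the right block, where it stands
behind the \<open>card I\<close> letters of the left one.\<close>

lemma split_sign_first_left:
  assumes "I \<subseteq> {..<a}"
  shows "split_sign (Suc a) (insert 0 (Suc ` I)) = split_sign a I"
proof -
  have fin: "finite I" using assms finite_subset by blast
  have "{..<Suc a} - insert 0 (Suc ` I) = Suc ` ({..<a} - I)"
    by (auto simp: lessThan_Suc_eq_insert_0)
  then have "split_sign (Suc a) (insert 0 (Suc ` I)) =
     sign (listing (0 # map Suc (sorted_list_of_set I @ sorted_list_of_set ({..<a} - I))))"
    using assms fin
    by (subst split_sign_listing)
       (auto simp: sorted_list_of_set_Suc_image insort_is_Cons)
  also have "\<dots> = split_sign a I"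
    by (subst sign_listing_shift)
       (use split_listing_props[OF assms] split_sign_listing[OF assms] in auto)
  finally show ?thesis .
qed

lemma split_sign_first_right:
  assumes "I \<subseteq> {..<a}"
  shows "split_sign (Suc a) (Suc ` I) = (- 1) ^ card I * split_sign a I"
proof -
  have fin: "finite I" using assms finite_subset by blast
  let ?xs = "sorted_list_of_set I" and ?ys = "sorted_list_of_set ({..<a} - I)"
  note props = split_listing_props[OF assms]
  have eq: "{..<Suc a} - Suc ` I = insert 0 (Suc ` ({..<a} - I))"
    by (auto simp: lessThan_Suc_eq_insert_0)
  have dist: "distinct (map Suc ?xs @ 0 # map Suc ?ys)"
    using props(1) by (auto simp: distinct_map)
  have "set (map Suc ?xs @ 0 # map Suc ?ys) = insert 0 (Suc ` set (?xs @ ?ys))"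
    by auto
  also have "\<dots> = {..<length (map Suc ?xs @ 0 # map Suc ?ys)}"
    unfolding props(2) by (auto simp: lessThan_Suc_eq_insert_0)
  finally have set: "set (map Suc ?xs @ 0 # map Suc ?ys) = {..<length (map Suc ?xs @ 0 # map Suc ?ys)}" .
  have "split_sign (Suc a) (Suc ` I) = sign (listing (map Suc ?xs @ 0 # map Suc ?ys))"
    using assms fin
    by (subst split_sign_listing) (auto simp: eq sorted_list_of_set_Suc_image insort_is_Cons)
  also have "\<dots> = (- 1) ^ card I * sign (listing (0 # map Suc (?xs @ ?ys)))"
    using sign_listing_move[OF dist set] fin by simp
  also have "sign (listing (0 # map Suc (?xs @ ?ys))) = split_sign a I"
    by (subst sign_listing_shift)
       (use split_listing_props[OF assms] split_sign_listing[OF assms] in auto)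
  finally show ?thesis .
qed

section \<open>Recursions for coproduct slices\<close>

lemma ext_prod_Nil [simp]: "ext_prod \<iota> [] = 1"
  and ext_prod_Cons [simp]: "ext_prod \<iota> (v # vs) = \<iota> v * ext_prod \<iota> vs"
  and ext_prod_append [simp]: "ext_prod \<iota> (us @ vs) = ext_prod \<iota> us * ext_prod \<iota> vs"
  by (simp_all add: ext_prod_def)

lemma minus_one_powi:
  "(- 1 :: 'k :: field) powi i = (if even i then 1 else - 1)"
  by (cases i rule: int_cases2) (auto simp: power_int_minus minus_one_power_iff)

lemma subsets_with_complement_Suc:
  fixes a :: nat
  shows "{I. I \<subseteq> {..<Suc a} \<and> int (card I) = i \<and> int (card ({..<Suc a} - I)) = j} =
    (\<lambda>I. insert 0 (Suc ` I)) ` {I. I \<subseteq> {..<a} \<and> int (card I) = i - 1 \<and> int (card ({..<a} - I)) = j} \<union>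
    (\<lambda>I. Suc ` I) ` {I. I \<subseteq> {..<a} \<and> int (card I) = i \<and> int (card ({..<a} - I)) = j - 1}"
    (is "?A = ?f ` ?B \<union> ?g ` ?C")
proof -
  have c1: "{..<Suc a} - insert 0 (Suc ` I) = Suc ` ({..<a} - I)"
    and c2: "{..<Suc a} - Suc ` I = insert 0 (Suc ` ({..<a} - I))" for I
    by (auto simp: lessThan_Suc_eq_insert_0)
  have k1: "card (insert 0 (Suc ` I)) = Suc (card I)" if "I \<subseteq> {..<a}" for I
    using finite_subset[OF that] by (simp add: card_image)
  show ?thesis
  proof (intro equalityI subsetI)
    fix I assume I: "I \<in> ?A"
    let ?I = "{k. Suc k \<in> I}"
    have sub: "?I \<subseteq> {..<a}" using I by auto
    show "I \<in> ?f ` ?B \<union> ?g ` ?C"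
    proof (cases "0 \<in> I")
      case True
      have eq: "I = ?f ?I" using True by (auto simp: image_iff) (metis not0_implies_Suc)
      have "?I \<in> ?B"
        using I k1[OF sub] c1[of ?I] sub unfolding eq[symmetric] by (auto simp: card_image)
      with eq show ?thesis by blast
    next
      case False
      have eq: "I = ?g ?I" using False by (auto simp: image_iff) (metis not0_implies_Suc)
      have "?I \<in> ?C"
        using I k1[of "{..<a} - ?I"] c2[of ?I] sub card_image[of Suc ?I] unfolding eq[symmetric] by auto
      with eq show ?thesis by blast
    qed
  next
    fix I assume "I \<in> ?f ` ?B \<union> ?g ` ?C"
    then show "I \<in> ?A"
    proof
      assume "I \<in> ?f ` ?B"
      then obtain J where "J \<in> ?B" "I = ?f J" by blast
      then show ?thesis using k1[of J] c1[of J] by (auto simp: card_image)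
    next
      assume "I \<in> ?g ` ?C"
      then obtain J where "J \<in> ?C" "I = ?g J" by blast
      then show ?thesis using k1[of "{..<a} - J"] c2[of J] by (auto simp: card_image)
    qed
  qed
qed

lemma slice_sum_neg:
  assumes "i < 0 \<or> j < 0"
  shows "slice_sum sT \<iota> vs i j g = 0"
proof -
  have "{I. I \<subseteq> {..<length vs} \<and> int (card I) = i \<and> int (card ({..<length vs} - I)) = j} = {}"
    using assms by auto
  then show ?thesis by (simp only: slice_sum_def sum.empty)
qed

text \<open>The two factors of a slice are products of words of the prescribed lengths, so two expressions in
them need only agree there.\<close>

lemma slice_sum_cong:
  assumes "\<And>us ws. int (length us) = i \<Longrightarrow> int (length ws) = j \<Longrightarrow>
      g (ext_prod \<iota> us) (ext_prod \<iota> ws) = g' (ext_prod \<iota> us) (ext_prod \<iota> ws)"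
  shows "slice_sum sT \<iota> vs i j g = slice_sum sT \<iota> vs i j g'"
  unfolding slice_sum_def
proof (rule sum.cong[OF refl])
  fix I
  assume I: "I \<in> {I. I \<subseteq> {..<length vs} \<and> int (card I) = i \<and> int (card ({..<length vs} - I)) = j}"
  then have "{k. k < length vs \<and> k \<in> I} = I"
    "{k. k < length vs \<and> k \<in> {..<length vs} - I} = {..<length vs} - I"
    by auto
  then have "int (length (nths vs I)) = i" "int (length (nths vs ({..<length vs} - I))) = j"
    using I by (simp_all only: length_nths) auto
  from assms[OF this]
  show "sT (of_int (split_sign (length vs) I))
          (g (ext_prod \<iota> (nths vs I)) (ext_prod \<iota> (nths vs ({..<length vs} - I)))) =
        sT (of_int (split_sign (length vs) I))
          (g' (ext_prod \<iota> (nths vs I)) (ext_prod \<iota> (nths vs ({..<length vs} - I))))"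
    by simp
qed

text \<open>Applied to \<open>\<ast> \<otimes> \<ast>\<close> and to contractions of one tensor factor.\<close>

lemma slice_sum_linear_image:
  assumes "Vector_Spaces.linear sT sW L"
  shows "L (slice_sum sT \<iota> vs i j g) = slice_sum sW \<iota> vs i j (\<lambda>x y. L (g x y))"
proof -
  interpret Vector_Spaces.linear sT sW L by fact
  show ?thesis by (simp add: slice_sum_def sum scale)
qed

lemma slice_sum_fun_add:
  assumes "vector_space sT"
  shows "slice_sum sT \<iota> vs i j (\<lambda>x y. g x y + g' x y) =
     slice_sum sT \<iota> vs i j g + slice_sum sT \<iota> vs i j g'"
proof -
  interpret vector_space sT by fact
  show ?thesis by (simp add: slice_sum_def scale_right_distrib sum.distrib)
qed

lemma slice_sum_fun_scale:
  assumes "vector_space sT"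
  shows "slice_sum sT \<iota> vs i j (\<lambda>x y. sT c (g x y)) = sT c (slice_sum sT \<iota> vs i j g)"
proof -
  interpret vector_space sT by fact
  show ?thesis by (simp add: slice_sum_def scale_sum_right mult.commute)
qed

lemma slice_sum_fun_zero:
  assumes "vector_space sT"
  shows "slice_sum sT \<iota> vs i j (\<lambda>x y. 0) = 0"
proof -
  interpret vector_space sT by fact
  show ?thesis by (simp add: slice_sum_def)
qed

lemma slice_sum_fun_diff:
  assumes "vector_space sT"
  shows "slice_sum sT \<iota> vs i j (\<lambda>x y. g x y - g' x y) =
     slice_sum sT \<iota> vs i j g - slice_sum sT \<iota> vs i j g'"
proof -
  interpret vector_space sT by fact
  show ?thesis by (simp add: slice_sum_def scale_right_diff_distrib sum_subtractf)
qed

lemma slice_sum_Nil: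
  assumes "vector_space sT"
  shows "slice_sum sT \<iota> [] i j g = (if i = 0 \<and> j = 0 then g 1 1 else 0)"
proof -
  interpret vector_space sT by fact
  have "{I. I \<subseteq> {..<0::nat} \<and> int (card I) = i \<and> int (card ({..<0} - I)) = j} =
        (if i = 0 \<and> j = 0 then {{}} else {})"
    by auto
  moreover have "split_sign 0 {} = 1"
    by (simp add: split_sign_def)
  ultimately show ?thesis
    by (simp add: slice_sum_def)
qed

text \<open>The coproduct is multiplicative: the first letter goes to the left factor, or to the right factor
past the \<open>i\<close> letters of the left one. The slice indices are integers, so the boundary cases need no
separate treatment. All later facts on slices come from this recursion and \<open>slice_sum_Nil\<close>, without
further reference to subsets or permutations.\<close>

lemma slice_sum_Cons:
  fixes sT :: "'k :: field \<Rightarrow> 't :: ab_group_add \<Rightarrow> 't"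
  assumes "vector_space sT"
  shows "slice_sum sT \<iota> (v # vs) i j g =
    slice_sum sT \<iota> vs (i - 1) j (\<lambda>x y. g (\<iota> v * x) y) +
    sT ((- 1) powi i) (slice_sum sT \<iota> vs i (j - 1) (\<lambda>x y. g x (\<iota> v * y)))"
proof -
  interpret vector_space sT by fact
  let ?a = "length vs"
  let ?B = "{I. I \<subseteq> {..<?a} \<and> int (card I) = i - 1 \<and> int (card ({..<?a} - I)) = j}"
  let ?C = "{I. I \<subseteq> {..<?a} \<and> int (card I) = i \<and> int (card ({..<?a} - I)) = j - 1}"
  let ?f = "\<lambda>I. insert 0 (Suc ` I)"
  let ?t = "\<lambda>I. sT (of_int (split_sign (Suc ?a) I))
      (g (ext_prod \<iota> (nths (v # vs) I)) (ext_prod \<iota> (nths (v # vs) ({..<Suc ?a} - I))))"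
  have fin: "finite ?B" "finite ?C"
    by (rule finite_subset[of _ "Pow {..<?a}"]; auto)+
  have inj: "inj_on ?f ?B" "inj_on ((`) Suc) ?C"
    by (auto intro!: inj_onI simp: insert_ident inj_image_eq_iff)
  have c1: "{..<Suc ?a} - insert 0 (Suc ` I) = Suc ` ({..<?a} - I)"
    and c2: "{..<Suc ?a} - Suc ` I = insert 0 (Suc ` ({..<?a} - I))" for I
    by (auto simp: lessThan_Suc_eq_insert_0)
  have s: "{k. Suc k \<in> Suc ` I} = I" "{k. Suc k \<in> insert 0 (Suc ` I)} = I" for I
    by auto
  have "slice_sum sT \<iota> (v # vs) i j g = sum ?t (?f ` ?B \<union> (`) Suc ` ?C)"
    unfolding slice_sum_def list.size One_nat_def add_0_right add_Suc_right
      subsets_with_complement_Suc ..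
  also have "\<dots> = sum ?t (?f ` ?B) + sum ?t ((`) Suc ` ?C)"
    by (rule sum.union_disjoint) (use fin in auto)
  also have "sum ?t (?f ` ?B) = slice_sum sT \<iota> vs (i - 1) j (\<lambda>x y. g (\<iota> v * x) y)"
    unfolding slice_sum_def sum.reindex[OF inj(1)] comp_def
    by (rule sum.cong[OF refl]) (simp add: split_sign_first_left c1 s nths_Cons)
  also have "sum ?t ((`) Suc ` ?C) =
      sT ((- 1) powi i) (slice_sum sT \<iota> vs i (j - 1) (\<lambda>x y. g x (\<iota> v * y)))"
    unfolding slice_sum_def sum.reindex[OF inj(2)] comp_def scale_sum_right
    by (rule sum.cong[OF refl]) (auto simp: split_sign_first_right c2 s nths_Cons minus_one_powi
        minus_one_power_iff)
  finally show ?thesis .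
qed

lemma slice_sum_all_right:
  assumes "vector_space sT"
  shows "slice_sum sT \<iota> vs 0 (int (length vs)) g = g 1 (ext_prod \<iota> vs)"
proof (induction vs arbitrary: g)
  case (Cons v vs)
  interpret vector_space sT by fact
  from Cons show ?case
    by (simp add: slice_sum_Cons[OF assms] slice_sum_neg)
qed (simp add: slice_sum_Nil[OF assms])

text \<open>The mirror image of \<open>slice_sum_Cons\<close>: a last letter in the left factor has to pass the \<open>j\<close> letters of
the right one.\<close>

lemma slice_sum_snoc:
  fixes sT :: "'k :: field \<Rightarrow> 't :: ab_group_add \<Rightarrow> 't"
  assumes "vector_space sT"
  shows "slice_sum sT \<iota> (vs @ [v]) i j g =
    slice_sum sT \<iota> vs i (j - 1) (\<lambda>x y. g x (y * \<iota> v)) +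
    sT ((- 1) powi j) (slice_sum sT \<iota> vs (i - 1) j (\<lambda>x y. g (x * \<iota> v) y))"
proof (induction vs arbitrary: i j g)
  case Nil
  interpret vector_space sT by fact
  show ?case
    by (auto simp: slice_sum_Cons[OF assms] slice_sum_Nil[OF assms] minus_one_powi)
next
  case (Cons w vs)
  interpret vector_space sT by fact
  show ?case
    by (auto simp: slice_sum_Cons[OF assms] Cons minus_one_powi mult.assoc)
qed

section \<open>Linear maps out of a presented space\<close>

lemma lookup_free_scale [simp]:
  "Poly_Mapping.lookup (free_scale c p) x = c * Poly_Mapping.lookup p x"
  by (simp add: free_scale_def Poly_Mapping.map.rep_eq when_def)

lemma vector_space_mult: "vector_space ((*) :: 'k::field \<Rightarrow> 'k \<Rightarrow> 'k)"
  by unfold_locales (auto simp: algebra_simps)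

lemma vector_space_free_scale: "vector_space free_scale"
  by unfold_locales (auto intro!: poly_mapping_eqI simp: lookup_add algebra_simps)

lemma free_extend_superset:
  assumes "vector_space s" "finite S" "Poly_Mapping.keys p \<subseteq> S"
  shows "free_extend s g p = (\<Sum>x\<in>S. s (Poly_Mapping.lookup p x) (g x))"
proof -
  interpret vector_space s by fact
  show ?thesis
    unfolding free_extend_def
    by (rule sum.mono_neutral_left) (use assms in \<open>auto simp: in_keys_iff\<close>)
qed

lemma linear_free_extend:
  assumes "vector_space s"
  shows "Vector_Spaces.linear free_scale s (free_extend s g)"
proof -
  interpret vector_space s by fact
  have "free_extend s g (p + q) = free_extend s g p + free_extend s g q" for p q
  proof -
    let ?S = "Poly_Mapping.keys p \<union> Poly_Mapping.keys q"
    have "Poly_Mapping.keys (p + q) \<subseteq> ?S" by (rule Poly_Mapping.keys_add)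
    then show ?thesis
      by (simp add: free_extend_superset[OF assms, of ?S] lookup_add scale_left_distrib
          sum.distrib)
  qed
  moreover have "free_extend s g (free_scale c p) = s c (free_extend s g p)" for c p
  proof -
    have "Poly_Mapping.keys (free_scale c p) \<subseteq> Poly_Mapping.keys p"
      by (auto simp: in_keys_iff)
    then show ?thesis
      by (simp add: free_extend_superset[OF assms, of "Poly_Mapping.keys p"] scale_sum_right)
  qed
  ultimately show ?thesis
    by (simp add: linear_iff assms vector_space_free_scale)
qed

lemma free_extend_single [simp]:
  "vector_space s \<Longrightarrow> free_extend s g (Poly_Mapping.single x c) = s c (g x)"
  by (subst free_extend_superset[of s "{x}"]) auto

lemma free_extend_diff [simp]:
  assumes "vector_space s"
  shows "free_extend s g (p - q) = free_extend s g p - free_extend s g q"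
proof -
  interpret Vector_Spaces.linear free_scale s "free_extend s g"
    by (rule linear_free_extend[OF assms])
  show ?thesis by (rule diff)
qed

lemma presented_by_kills_relations:
  assumes "presented_by s g R" "r \<in> R"
  shows "free_extend s g r = 0"
proof -
  interpret F: vector_space "free_scale :: 'a \<Rightarrow> ('c \<Rightarrow>\<^sub>0 'a) \<Rightarrow> _"
    by (rule vector_space_free_scale)
  show ?thesis
    using assms F.span_base by (auto simp: presented_by_def)
qed

lemma linear_eq_on_generators:
  assumes pres: "presented_by s g R"
    and f: "Vector_Spaces.linear s s' f" and f': "Vector_Spaces.linear s s' f'"
    and eq: "\<And>x. f (g x) = f' (g x)"
  shows "f = f'"
proof
  fix e
  interpret f: Vector_Spaces.linear s s' f by fact
  interpret f': Vector_Spaces.linear s s' f' by fact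
  obtain p where p: "e = free_extend s g p"
    using pres by (metis presented_by_def surjD)
  show "f e = f' e"
    unfolding p free_extend_def by (simp add: f.sum f'.sum f.scale f'.scale eq)
qed

text \<open>The universal property of generators and relations: the map on generators extends to the free
space, its extension vanishes on the span of the relations, and that span is the whole kernel of the
presentation.\<close>

lemma presented_by_lift:
  assumes pres: "presented_by s g R" and s: "vector_space s" and s': "vector_space s'"
    and rel: "\<And>r. r \<in> R \<Longrightarrow> free_extend s' \<phi> r = 0"
  shows "\<exists>L. Vector_Spaces.linear s s' L \<and> (\<forall>x. L (g x) = \<phi> x)"
proof -
  interpret F: Vector_Spaces.linear free_scale s "free_extend s g"
    by (rule linear_free_extend[OF s])
  interpret F': Vector_Spaces.linear free_scale s' "free_extend s' \<phi>"
    by (rule linear_free_extend[OF s'])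
  have ker: "free_extend s' \<phi> p = 0" if "free_extend s g p = 0" for p
  proof -
    have "p \<in> F.vs1.span R" using pres that by (auto simp: presented_by_def)
    moreover have "F.vs1.span R \<subseteq> {p. free_extend s' \<phi> p = 0}"
      by (rule F.vs1.span_minimal) (auto simp: rel F'.subspace_kernel)
    ultimately show ?thesis by blast
  qed
  have eq: "free_extend s' \<phi> p = free_extend s' \<phi> q" if "free_extend s g p = free_extend s g q" for p q
    using ker[of "p - q"] that s s' by simp
  \<comment> \<open>Any preimage will do, by the equality of values on the fibres just shown.\<close>
  define L where "L e = free_extend s' \<phi> (inv (free_extend s g) e)" for e
  have surj: "surj (free_extend s g)" using pres by (simp add: presented_by_def)
  have L: "L (free_extend s g p) = free_extend s' \<phi> p" for p
    unfolding L_def by (rule eq) (simp add: surj_f_inv_f[OF surj])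
  have "L (x + y) = L x + L y" for x y
    using surjD[OF surj, of x] surjD[OF surj, of y]
    by (auto simp: L F'.add simp flip: F.add)
  moreover have "L (s c x) = s' c (L x)" for c x
    using surjD[OF surj, of x] by (auto simp: L F'.scale simp flip: F.scale)
  moreover have "L (g x) = \<phi> x" for x
    using L[of "Poly_Mapping.single x 1"] s s'
    by (simp add: vector_space.vector_space_assms(4))
  ultimately show ?thesis
    using s s' by (auto simp: linear_iff)
qed

section \<open>Tensor products\<close>

definition bilinear_map ::
  "('k::field \<Rightarrow> 'a::ab_group_add \<Rightarrow> 'a) \<Rightarrow> ('k \<Rightarrow> 'b::ab_group_add \<Rightarrow> 'b) \<Rightarrow>
   ('k \<Rightarrow> 'c::ab_group_add \<Rightarrow> 'c) \<Rightarrow> ('a \<Rightarrow> 'b \<Rightarrow> 'c) \<Rightarrow> bool" where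
  "bilinear_map sA sB sC \<beta> \<longleftrightarrow>
     (\<forall>y. Vector_Spaces.linear sA sC (\<lambda>x. \<beta> x y)) \<and> (\<forall>x. Vector_Spaces.linear sB sC (\<beta> x))"

locale tensor_product =
  fixes scaleA :: "'k::field \<Rightarrow> 'a::ab_group_add \<Rightarrow> 'a"
    and scaleB :: "'k \<Rightarrow> 'b::ab_group_add \<Rightarrow> 'b"
    and scaleT :: "'k \<Rightarrow> 't::ab_group_add \<Rightarrow> 't"
    and tens :: "'a \<Rightarrow> 'b \<Rightarrow> 't"
  assumes tensor: "is_tensor_product scaleA scaleB scaleT tens"
begin

sublocale A: vector_space scaleA using tensor by (simp add: is_tensor_product_def)
sublocale B: vector_space scaleB using tensor by (simp add: is_tensor_product_def)
sublocale T: vector_space scaleT using tensor by (simp add: is_tensor_product_def)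

lemma presentation: "presented_by scaleT (\<lambda>(x, y). tens x y) (tensor_relations scaleA scaleB)"
  using tensor by (simp add: is_tensor_product_def)

lemma tens_add_left: "tens (x + x') y = tens x y + tens x' y"
proof -
  have "Poly_Mapping.single (x + x', y) 1 - Poly_Mapping.single (x, y) 1 - Poly_Mapping.single (x', y) 1
    \<in> tensor_relations scaleA scaleB"
    unfolding tensor_relations_def by blast
  from presented_by_kills_relations[OF presentation this] show ?thesis
    by (simp add: T.vector_space_axioms diff_eq_eq add.commute)
qed

lemma tens_add_right: "tens x (y + y') = tens x y + tens x y'"
proof -
  have "Poly_Mapping.single (x, y + y') 1 - Poly_Mapping.single (x, y) 1 - Poly_Mapping.single (x, y') 1
    \<in> tensor_relations scaleA scaleB"
    unfolding tensor_relations_def by blast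
  from presented_by_kills_relations[OF presentation this] show ?thesis
    by (simp add: T.vector_space_axioms diff_eq_eq add.commute)
qed

lemma tens_scale_left: "tens (scaleA c x) y = scaleT c (tens x y)"
proof -
  have "Poly_Mapping.single (scaleA c x, y) 1 - Poly_Mapping.single (x, y) c
    \<in> tensor_relations scaleA scaleB"
    unfolding tensor_relations_def by blast
  from presented_by_kills_relations[OF presentation this] show ?thesis
    by (simp add: T.vector_space_axioms diff_eq_eq add.commute)
qed

lemma tens_scale_right: "tens x (scaleB c y) = scaleT c (tens x y)"
proof -
  have "Poly_Mapping.single (x, scaleB c y) 1 - Poly_Mapping.single (x, y) c
    \<in> tensor_relations scaleA scaleB"
    unfolding tensor_relations_def by blast
  from presented_by_kills_relations[OF presentation this] show ?thesis
    by (simp add: T.vector_space_axioms diff_eq_eq add.commute)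
qed

lemma bilinear_tens: "bilinear_map scaleA scaleB scaleT tens"
  by (simp add: bilinear_map_def linear_iff A.vector_space_axioms B.vector_space_axioms
      T.vector_space_axioms tens_add_left tens_add_right tens_scale_left tens_scale_right)

lemma tensor_lift:
  assumes "bilinear_map scaleA scaleB scaleW \<beta>"
  shows "\<exists>L. Vector_Spaces.linear scaleT scaleW L \<and> (\<forall>x y. L (tens x y) = \<beta> x y)"
proof -
  have W: "vector_space scaleW" using assms by (auto simp: bilinear_map_def linear_iff)
  then interpret W: vector_space scaleW .
  have "free_extend scaleW (\<lambda>(x, y). \<beta> x y) r = 0" if "r \<in> tensor_relations scaleA scaleB" for r
    using that assms W by (auto simp: tensor_relations_def bilinear_map_def linear_iff)
  from presented_by_lift[OF presentation T.vector_space_axioms W this] show ?thesis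
    by auto
qed

lemma linear_eq_on_tensors:
  assumes "Vector_Spaces.linear scaleT scaleW f" "Vector_Spaces.linear scaleT scaleW f'"
    and "\<And>x y. f (tens x y) = f' (tens x y)"
  shows "f = f'"
  using linear_eq_on_generators[OF presentation assms(1,2)] assms(3) by auto

end

lemma
  assumes "is_tensor_product scaleA scaleA scaleT tens"
    and f: "Vector_Spaces.linear scaleA scaleA f" and g: "Vector_Spaces.linear scaleA scaleA g"
  shows linear_tensor_map: "Vector_Spaces.linear scaleT scaleT (tensor_map scaleT tens f g)"
    and tensor_map_tens: "tensor_map scaleT tens f g (tens x y) = tens (f x) (g y)"
proof -
  interpret tensor_product scaleA scaleA scaleT tens
    using assms(1) by unfold_locales
  have "bilinear_map scaleA scaleA scaleT (\<lambda>x y. tens (f x) (g y))"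
    using f g bilinear_tens by (simp add: bilinear_map_def linear_iff)
  from tensor_lift[OF this]
  have "\<exists>!L. Vector_Spaces.linear scaleT scaleT L \<and> (\<forall>x y. L (tens x y) = tens (f x) (g y))"
    by (auto intro: linear_eq_on_tensors)
  from theI'[OF this] show "Vector_Spaces.linear scaleT scaleT (tensor_map scaleT tens f g)"
    and "tensor_map scaleT tens f g (tens x y) = tens (f x) (g y)"
    by (simp_all add: tensor_map_def)
qed

section \<open>Exterior algebras\<close>

text \<open>The conditions under which a function of words factors through the exterior algebra. Words of all
lengths are treated at once; each condition relates words of a single length, so the function may depend on
the length in any way.\<close>

definition alternating_words ::
  "('k::field \<Rightarrow> 'v::ab_group_add \<Rightarrow> 'v) \<Rightarrow> ('k \<Rightarrow> 'w::ab_group_add \<Rightarrow> 'w) \<Rightarrow> ('v list \<Rightarrow> 'w) \<Rightarrow> bool" where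
  "alternating_words sV sW \<phi> \<longleftrightarrow>
     (\<forall>us v v' ws. \<phi> (us @ (v + v') # ws) = \<phi> (us @ v # ws) + \<phi> (us @ v' # ws)) \<and>
     (\<forall>us c v ws. \<phi> (us @ sV c v # ws) = sW c (\<phi> (us @ v # ws))) \<and>
     (\<forall>us v ws. \<phi> (us @ v # v # ws) = 0)"

locale exterior_algebra =
  fixes scaleV :: "'k::field \<Rightarrow> 'v::ab_group_add \<Rightarrow> 'v"
    and scaleE :: "'k \<Rightarrow> 'e::ring_1 \<Rightarrow> 'e"
    and \<iota> :: "'v \<Rightarrow> 'e"
  assumes exterior: "is_exterior_algebra scaleV scaleE \<iota>"
begin

sublocale V: vector_space scaleV using exterior by (simp add: is_exterior_algebra_def)
sublocale E: vector_space scaleE using exterior by (simp add: is_exterior_algebra_def)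

lemma presentation: "presented_by scaleE (ext_prod \<iota>) (exterior_relations scaleV)"
  using exterior by (simp add: is_exterior_algebra_def)

lemma scale_mult: "scaleE c x * y = scaleE c (x * y)" "x * scaleE c y = scaleE c (x * y)"
  using exterior unfolding is_exterior_algebra_def by metis+

lemma iota_add: "\<iota> (v + v') = \<iota> v + \<iota> v'"
proof -
  have "Poly_Mapping.single ([] @ (v + v') # []) 1 - Poly_Mapping.single ([] @ v # []) 1
        - Poly_Mapping.single ([] @ v' # []) 1
    \<in> exterior_relations scaleV"
    unfolding exterior_relations_def by blast
  from presented_by_kills_relations[OF presentation this] show ?thesis
    by (simp add: E.vector_space_axioms diff_eq_eq add.commute)
qed

lemma iota_scale: "\<iota> (scaleV c v) = scaleE c (\<iota> v)"
proof -
  have "Poly_Mapping.single ([] @ scaleV c v # []) 1 - Poly_Mapping.single ([] @ v # []) c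
    \<in> exterior_relations scaleV"
    unfolding exterior_relations_def by blast
  from presented_by_kills_relations[OF presentation this] show ?thesis
    by (simp add: E.vector_space_axioms diff_eq_eq add.commute)
qed

lemma iota_zero: "\<iota> 0 = 0"
  using iota_scale[of 0 0] by simp

lemma iota_square: "\<iota> v * \<iota> v = 0"
proof -
  have "Poly_Mapping.single ([] @ v # v # []) 1
    \<in> exterior_relations scaleV"
    unfolding exterior_relations_def by blast
  from presented_by_kills_relations[OF presentation this] show ?thesis
    by (simp add: E.vector_space_axioms diff_eq_eq add.commute)
qed

lemma iota_square_left [simp]: "\<iota> v * (\<iota> v * x) = 0"
  by (simp add: iota_square flip: mult.assoc)

lemma iota_anticommute: "\<iota> v * \<iota> w = - (\<iota> w * \<iota> v)"
  using iota_square[of "v + w"] by (simp add: iota_add algebra_simps iota_square eq_neg_iff_add_eq_0)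

lemma exterior_lift:
  assumes W: "vector_space scaleW" and "alternating_words scaleV scaleW \<phi>"
  shows "\<exists>L. Vector_Spaces.linear scaleE scaleW L \<and> (\<forall>vs. L (ext_prod \<iota> vs) = \<phi> vs)"
proof -
  interpret W: vector_space scaleW by fact
  have "free_extend scaleW \<phi> r = 0" if "r \<in> exterior_relations scaleV" for r
    using that assms by (auto simp: exterior_relations_def alternating_words_def)
  from presented_by_lift[OF presentation E.vector_space_axioms W this] show ?thesis .
qed

lemma linear_eq_on_words:
  assumes "Vector_Spaces.linear scaleE scaleW f" "Vector_Spaces.linear scaleE scaleW f'"
    and "\<And>vs. f (ext_prod \<iota> vs) = f' (ext_prod \<iota> vs)"
  shows "f x = f' x"
  using linear_eq_on_generators[OF presentation assms(1,2)] assms(3) by simp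

text \<open>Every element is a linear combination of products of vectors. The case of the zero element is the
scaling case with factor \<open>0\<close>.\<close>

lemma exterior_induct [case_names one add scale iota]:
  assumes one: "P 1"
    and add: "\<And>x y. P x \<Longrightarrow> P y \<Longrightarrow> P (x + y)"
    and scale: "\<And>c x. P x \<Longrightarrow> P (scaleE c x)"
    and iota: "\<And>v x. P x \<Longrightarrow> P (\<iota> v * x)"
  shows "P x"
proof -
  have word: "P (ext_prod \<iota> vs)" for vs
    by (induction vs) (auto intro: one iota)
  have zero: "P 0" using scale[OF one, of 0] by simp
  obtain p where p: "x = free_extend scaleE (ext_prod \<iota>) p"
    using presentation by (metis presented_by_def surjD)
  have "P (\<Sum>vs\<in>S. scaleE (c vs) (ext_prod \<iota> vs))" if "finite S" for S c
    using that by induction (auto intro: zero add scale word)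
  then show ?thesis
    unfolding p free_extend_def by simp
qed

text \<open>The coefficient of the empty word respects all relations, since no relation involves the empty
word. This is the only source of non-vanishing: \<open>F \<noteq> 0\<close> will follow by contracting \<open>F\<close> down to \<open>1\<close>.\<close>

lemma one_neq_zero: "(1 :: 'e) \<noteq> 0"
proof -
  have "alternating_words scaleV (*) (\<lambda>vs. if vs = [] then 1 else 0 :: 'k)"
    by (simp add: alternating_words_def)
  from exterior_lift[OF vector_space_mult this] obtain L where
    L: "Vector_Spaces.linear scaleE (*) L" "\<And>vs. L (ext_prod \<iota> vs) = (if vs = [] then 1 else 0 :: 'k)"
    by auto
  interpret L: Vector_Spaces.linear scaleE "(*)" L by fact
  have "L 1 = 1" using L(2)[of "[]"] by simp
  then show ?thesis using L.zero by auto
qed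

lemma ext_prod_swap:
  "ext_prod \<iota> us * ext_prod \<iota> ws =
     scaleE ((- 1) ^ (length us * length ws)) (ext_prod \<iota> ws * ext_prod \<iota> us)"
proof -
  have one: "\<iota> u * ext_prod \<iota> ws = scaleE ((- 1) ^ length ws) (ext_prod \<iota> ws * \<iota> u)" for u ws
  proof (induction ws)
    case (Cons w ws)
    have "\<iota> u * ext_prod \<iota> (w # ws) = - (\<iota> w * (\<iota> u * ext_prod \<iota> ws))"
      using iota_anticommute[of u w] by (simp flip: mult.assoc)
    also have "\<dots> = scaleE ((- 1) ^ length (w # ws)) (ext_prod \<iota> (w # ws) * \<iota> u)"
      unfolding Cons by (simp add: scale_mult mult.assoc)
    finally show ?case .
  qed simp
  show ?thesis
  proof (induction us)
    case (Cons u us)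
    have "ext_prod \<iota> (u # us) * ext_prod \<iota> ws =
        scaleE ((- 1) ^ (length us * length ws)) ((\<iota> u * ext_prod \<iota> ws) * ext_prod \<iota> us)"
      by (simp add: mult.assoc Cons scale_mult)
    then show ?case
      by (simp add: one scale_mult mult.assoc power_add mult.commute)
  qed simp
qed

lemma ext_prod_move:
  "\<exists>\<epsilon> \<in> {1, - 1}. ext_prod \<iota> (us @ x # ws) = scaleE \<epsilon> (ext_prod \<iota> (x # us @ ws))"
proof -
  have "ext_prod \<iota> us * ext_prod \<iota> [x] =
     scaleE ((- 1) ^ length us) (ext_prod \<iota> [x] * ext_prod \<iota> us)"
    using ext_prod_swap[of us "[x]"] by simp
  then have "ext_prod \<iota> (us @ x # ws) = scaleE ((- 1) ^ length us) (ext_prod \<iota> (x # us @ ws))"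
    by (simp add: scale_mult flip: mult.assoc)
  then show ?thesis
    by (rule bexI) (auto simp: minus_one_power_iff)
qed

lemma ext_prod_permute:
  assumes "mset xs = mset ys"
  shows "\<exists>\<epsilon> \<in> {1, - 1}. ext_prod \<iota> xs = scaleE \<epsilon> (ext_prod \<iota> ys)"
  using assms
proof (induction xs arbitrary: ys)
  case Nil
  then show ?case by auto
next
  case (Cons x xs)
  then have "x \<in> set ys" by (metis list.set_intros(1) mset_eq_setD)
  then obtain us ws where ys: "ys = us @ x # ws" by (meson split_list)
  with Cons obtain \<epsilon> where e: "\<epsilon> \<in> {1, - 1}" "ext_prod \<iota> xs = scaleE \<epsilon> (ext_prod \<iota> (us @ ws))"
    by (metis (no_types, lifting) add_mset_remove_trivial mset.simps(2) mset_append union_mset_add_mset_right)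
  obtain \<delta> where d: "\<delta> \<in> {1, - 1}" "ext_prod \<iota> ys = scaleE \<delta> (ext_prod \<iota> (x # us @ ws))"
    using ext_prod_move ys by blast
  have "ext_prod \<iota> (x # xs) = scaleE (\<epsilon> * \<delta>) (ext_prod \<iota> ys)"
    using d(1) by (auto simp: e(2) d(2) scale_mult)
  moreover have "\<epsilon> * \<delta> \<in> {1, - 1}" using e(1) d(1) by auto
  ultimately show ?case by blast
qed

lemma ext_prod_not_distinct:
  assumes "\<not> distinct xs"
  shows "ext_prod \<iota> xs = 0"
proof -
  obtain us y ws zs where xs: "xs = us @ [y] @ ws @ [y] @ zs"
    using assms not_distinct_decomp by blast
  have "mset xs = mset (y # y # us @ ws @ zs)" by (simp add: xs)
  from ext_prod_permute[OF this] show ?thesis by auto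
qed

text \<open>The grade involution: it multiplies products of \<open>k\<close> vectors by \<open>(-1)\<^sup>k\<close>. It records the sign in the
Leibniz rule for contractions without any reference to homogeneous components.\<close>

definition involute :: "'e \<Rightarrow> 'e" where
  "involute = (SOME L. Vector_Spaces.linear scaleE scaleE L \<and>
     (\<forall>vs. L (ext_prod \<iota> vs) = scaleE ((- 1) ^ length vs) (ext_prod \<iota> vs)))"

lemma linear_involute: "Vector_Spaces.linear scaleE scaleE involute"
  and involute_ext_prod: "involute (ext_prod \<iota> vs) = scaleE ((- 1) ^ length vs) (ext_prod \<iota> vs)"
proof -
  have "alternating_words scaleV scaleE (\<lambda>vs. scaleE ((- 1) ^ length vs) (ext_prod \<iota> vs))"
    by (simp add: alternating_words_def iota_add iota_scale distrib_left distrib_right scale_mult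
        E.scale_right_distrib mult.commute)
  from someI_ex[OF exterior_lift[OF E.vector_space_axioms this]]
  show "Vector_Spaces.linear scaleE scaleE involute"
    and "involute (ext_prod \<iota> vs) = scaleE ((- 1) ^ length vs) (ext_prod \<iota> vs)"
    unfolding involute_def by blast+
qed

sublocale involute: Vector_Spaces.linear scaleE scaleE involute
  by (rule linear_involute)

lemma involute_one [simp]: "involute 1 = 1"
  using involute_ext_prod[of "[]"] by simp

lemma involute_mult_iota: "involute (\<iota> v * x) = - (\<iota> v * involute x)"
proof (rule linear_eq_on_words[where scaleW = scaleE and x = x
      and f = "\<lambda>x. involute (\<iota> v * x)" and f' = "\<lambda>x. - (\<iota> v * involute x)"])
  show "Vector_Spaces.linear scaleE scaleE (\<lambda>x. involute (\<iota> v * x))"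
    "Vector_Spaces.linear scaleE scaleE (\<lambda>x. - (\<iota> v * involute x))"
    by (auto simp: linear_iff E.vector_space_axioms distrib_left scale_mult involute.add involute.scale)
  show "involute (\<iota> v * ext_prod \<iota> vs) = - (\<iota> v * involute (ext_prod \<iota> vs))" for vs
    using involute_ext_prod[of "v # vs"] by (simp add: involute_ext_prod scale_mult)
qed

end

section \<open>Coproduct slices as linear maps\<close>

context exterior_algebra
begin

lemma bilinear_mult_left:
  assumes "bilinear_map scaleE sB sW g"
  shows "bilinear_map scaleE sB sW (\<lambda>x y. g (z * x) y)"
  using assms by (simp add: bilinear_map_def linear_iff distrib_left scale_mult(2))

lemma bilinear_mult_right:
  assumes "bilinear_map sA scaleE sW g"
  shows "bilinear_map sA scaleE sW (\<lambda>x y. g x (z * y))"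
  using assms by (simp add: bilinear_map_def linear_iff distrib_left scale_mult(2))

text \<open>Multilinearity and alternation in the letters. In \<open>v # v # ws\<close> the terms with both copies of \<open>v\<close> in the
same factor vanish; the two terms that separate the copies differ by a transposition and cancel. Letters in
front are absorbed into the bilinear expression \<open>g\<close>, which is why \<open>g\<close> is generalised in the
induction.\<close>

lemma slice_sum_alternating:
  assumes "bilinear_map scaleE scaleE sW g"
  shows "slice_sum sW \<iota> (us @ (v + v') # ws) i j g =
      slice_sum sW \<iota> (us @ v # ws) i j g + slice_sum sW \<iota> (us @ v' # ws) i j g" (is ?add)
    and "slice_sum sW \<iota> (us @ scaleV c v # ws) i j g = sW c (slice_sum sW \<iota> (us @ v # ws) i j g)" (is ?scale)
    and "slice_sum sW \<iota> (us @ v # v # ws) i j g = 0" (is ?square)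
proof -
  have W: "vector_space sW" using assms by (auto simp: bilinear_map_def linear_iff)
  interpret W: vector_space sW by fact
  note rec = slice_sum_Cons[OF W] slice_sum_fun_add[OF W] slice_sum_fun_scale[OF W]
  from assms have "?add \<and> ?scale \<and> ?square"
  proof (induction us arbitrary: i j g)
    case Nil
    have g: "g (x + x') y = g x y + g x' y" "g x (y + y') = g x y + g x y'"
      "g (scaleE c x) y = sW c (g x y)" "g x (scaleE c y) = sW c (g x y)" for x x' y y' c
      using Nil by (auto simp: bilinear_map_def linear_iff)
    have g0: "g 0 y = 0" "g x 0 = 0" for x y
      using g(3)[of 0] g(4)[of _ 0] by simp_all
    have "slice_sum sW \<iota> (v # v # ws) i j g = 0"
      by (simp add: slice_sum_Cons[OF W] mult.assoc[symmetric] iota_square g0 slice_sum_fun_zero[OF W]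
          minus_one_powi)
    moreover have "slice_sum sW \<iota> ((v + v') # ws) i j g =
      slice_sum sW \<iota> (v # ws) i j g + slice_sum sW \<iota> (v' # ws) i j g"
      by (simp add: rec iota_add distrib_right g W.scale_right_distrib)
    moreover have "slice_sum sW \<iota> (scaleV c v # ws) i j g = sW c (slice_sum sW \<iota> (v # ws) i j g)"
      by (simp add: rec iota_scale scale_mult g W.scale_right_distrib mult.commute)
    ultimately show ?case by simp
  next
    case (Cons u us)
    note IH = Cons.IH[OF bilinear_mult_left[OF Cons.prems]] Cons.IH[OF bilinear_mult_right[OF Cons.prems]]
    show ?case
      by (simp add: slice_sum_Cons[OF W] IH W.scale_right_distrib mult.commute)
  qed
  then show ?add ?scale ?square by auto
qed

lemma slice_sum_lift:
  assumes "bilinear_map scaleE scaleE sW g"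
  shows "\<exists>L. Vector_Spaces.linear scaleE sW L \<and>
     (\<forall>vs. L (ext_prod \<iota> vs) = slice_sum sW \<iota> vs (i (length vs)) (j (length vs)) g)"
proof (rule exterior_lift)
  show "vector_space sW" using assms by (auto simp: bilinear_map_def linear_iff)
  show "alternating_words scaleV sW (\<lambda>vs. slice_sum sW \<iota> vs (i (length vs)) (j (length vs)) g)"
    by (simp add: alternating_words_def slice_sum_alternating[OF assms])
qed

text \<open>Both geometric products are of this form: the slice is taken in one argument, and the other argument
enters as the parameter \<open>z\<close>, on which the slice depends linearly.\<close>

lemma slice_sum_lift_family:
  assumes g: "\<And>z. bilinear_map scaleE scaleE sW (g z)"
    and lin: "\<And>x y. Vector_Spaces.linear sZ sW (\<lambda>z. g z x y)"
  shows "\<exists>L. bilinear_map sZ scaleE sW L \<and>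
     (\<forall>z vs. L z (ext_prod \<iota> vs) = slice_sum sW \<iota> vs (i (length vs)) (j (length vs)) (g z))"
proof -
  have W: "vector_space sW" and Z: "vector_space sZ" using lin by (auto simp: linear_iff)
  interpret W: vector_space sW by fact
  obtain L where L: "\<And>z. Vector_Spaces.linear scaleE sW (L z)"
    "\<And>z vs. L z (ext_prod \<iota> vs) = slice_sum sW \<iota> vs (i (length vs)) (j (length vs)) (g z)"
    using slice_sum_lift[OF g] by metis
  have "L (z + z') x = L z x + L z' x" for z z' x
  proof (rule linear_eq_on_words[where scaleW = sW])
    show "Vector_Spaces.linear scaleE sW (\<lambda>x. L z x + L z' x)"
      using L(1) by (simp add: linear_iff W.scale_right_distrib)
    have "g (z + z') = (\<lambda>x y. g z x y + g z' x y)"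
      using lin by (auto simp: fun_eq_iff linear_iff)
    then show "L (z + z') (ext_prod \<iota> vs) = L z (ext_prod \<iota> vs) + L z' (ext_prod \<iota> vs)" for vs
      by (simp add: L(2) slice_sum_fun_add[OF W])
  qed (rule L(1))
  moreover have "L (sZ c z) x = sW c (L z x)" for c z x
  proof (rule linear_eq_on_words[where scaleW = sW])
    show "Vector_Spaces.linear scaleE sW (\<lambda>x. sW c (L z x))"
      using L(1) by (simp add: linear_iff W.scale_right_distrib mult.commute)
    have "g (sZ c z) = (\<lambda>x y. sW c (g z x y))"
      using lin by (auto simp: fun_eq_iff linear_iff)
    then show "L (sZ c z) (ext_prod \<iota> vs) = sW c (L z (ext_prod \<iota> vs))" for vs
      by (simp add: L(2) slice_sum_fun_scale[OF W])
  qed (rule L(1))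
  ultimately have "bilinear_map sZ scaleE sW L"
    using L(1) by (simp add: bilinear_map_def linear_iff Z)
  with L(2) show ?thesis by blast
qed

end

section \<open>Contraction\<close>

text \<open>A bilinear form turns vectors into linear functionals, so that vectors can act on the exterior algebra
by contraction. For the Hodge star the form is the one that makes the given basis orthonormal.\<close>

locale exterior_algebra_with_form = exterior_algebra scaleV scaleE \<iota>
  for scaleV :: "'k::field \<Rightarrow> 'v::ab_group_add \<Rightarrow> 'v"
    and scaleE :: "'k \<Rightarrow> 'e::ring_1 \<Rightarrow> 'e"
    and \<iota> :: "'v \<Rightarrow> 'e" +
  fixes \<beta> :: "'v \<Rightarrow> 'v \<Rightarrow> 'k"
  assumes bilinear_form: "bilinear_map scaleV scaleV (*) \<beta>"
begin

lemma form_add: "\<beta> (v + v') w = \<beta> v w + \<beta> v' w" "\<beta> v (w + w') = \<beta> v w + \<beta> v w'"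
  and form_scale: "\<beta> (scaleV c v) w = c * \<beta> v w" "\<beta> v (scaleV c w) = c * \<beta> v w"
  using bilinear_form by (auto simp: bilinear_map_def linear_iff)

text \<open>Expanding the contraction of a word along its first letter; the sign is that of an antiderivation.\<close>

fun contract_word :: "'v \<Rightarrow> 'v list \<Rightarrow> 'e" where
  "contract_word v [] = 0"
| "contract_word v (w # ws) = scaleE (\<beta> v w) (ext_prod \<iota> ws) - \<iota> w * contract_word v ws"

lemma alternating_contract_word: "alternating_words scaleV scaleE (contract_word v)"
proof -
  have "contract_word v (us @ (w + w') # ws) = contract_word v (us @ w # ws) + contract_word v (us @ w' # ws)" for us w w' ws
    by (induction us) (simp_all add: form_add iota_add algebra_simps E.scale_left_distrib E.scale_right_distrib)
  moreover have "contract_word v (us @ scaleV c w # ws) = scaleE c (contract_word v (us @ w # ws))" for us w c ws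
    by (induction us) (simp_all add: form_scale iota_scale scale_mult E.scale_right_diff_distrib mult.commute)
  moreover have "contract_word v (us @ w # w # ws) = 0" for us w ws
    by (induction us) (simp_all add: right_diff_distrib scale_mult)
  ultimately show ?thesis by (simp add: alternating_words_def)
qed

definition contract :: "'v \<Rightarrow> 'e \<Rightarrow> 'e" where
  "contract v = (SOME L. Vector_Spaces.linear scaleE scaleE L \<and>
     (\<forall>ws. L (ext_prod \<iota> ws) = contract_word v ws))"

lemma linear_contract: "Vector_Spaces.linear scaleE scaleE (contract v)"
  and contract_ext_prod: "contract v (ext_prod \<iota> ws) = contract_word v ws"
  using someI_ex[OF exterior_lift[OF E.vector_space_axioms alternating_contract_word]]
  unfolding contract_def by blast+

sublocale contract: Vector_Spaces.linear scaleE scaleE "contract v" for v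
  by (rule linear_contract)

lemma contract_one [simp]: "contract v 1 = 0"
  using contract_ext_prod[of v "[]"] by simp

lemma contract_mult_iota: "contract v (\<iota> w * x) = scaleE (\<beta> v w) x - \<iota> w * contract v x"
proof (rule linear_eq_on_words[where scaleW = scaleE and x = x
      and f = "\<lambda>x. contract v (\<iota> w * x)" and f' = "\<lambda>x. scaleE (\<beta> v w) x - \<iota> w * contract v x"])
  show "Vector_Spaces.linear scaleE scaleE (\<lambda>x. contract v (\<iota> w * x))"
    "Vector_Spaces.linear scaleE scaleE (\<lambda>x. scaleE (\<beta> v w) x - \<iota> w * contract v x)"
    by (auto simp: linear_iff E.vector_space_axioms distrib_left scale_mult contract.add contract.scale
        E.scale_right_distrib E.scale_right_diff_distrib mult.commute)
  show "contract v (\<iota> w * ext_prod \<iota> vs) = scaleE (\<beta> v w) (ext_prod \<iota> vs) - \<iota> w * contract v (ext_prod \<iota> vs)" for vs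
    using contract_ext_prod[of v "w # vs"] by (simp add: contract_ext_prod)
qed

lemma contract_vector_add: "contract (v + w) x = contract v x + contract w x"
  by (induction x rule: exterior_induct)
     (simp_all add: contract.add contract.scale contract_mult_iota form_add E.scale_left_distrib
       E.scale_right_distrib distrib_left)

lemma contract_vector_scale: "contract (scaleV c v) x = scaleE c (contract v x)"
  by (induction x rule: exterior_induct)
     (simp_all add: contract.add contract.scale contract_mult_iota form_scale scale_mult
       E.scale_right_distrib E.scale_right_diff_distrib mult.commute)

lemma contract_contract [simp]: "contract v (contract v x) = 0"
  by (induction x rule: exterior_induct)
     (simp_all add: contract.add contract.scale contract.diff contract_mult_iota)

lemma involute_contract: "involute (contract v x) = - contract v (involute x)"
  by (induction x rule: exterior_induct)
     (simp_all add: contract.add contract.scale involute.add involute.scale contract.neg involute.neg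
       involute.diff contract_mult_iota involute_mult_iota)

text \<open>Contraction is an antiderivation: passing \<open>x\<close> costs the sign of the grade of \<open>x\<close>.\<close>

lemma contract_mult: "contract v (x * y) = contract v x * y + involute x * contract v y"
proof (induction x rule: exterior_induct)
  case (iota w x)
  have "contract v (\<iota> w * x * y) = scaleE (\<beta> v w) (x * y) - \<iota> w * contract v (x * y)"
    by (simp add: mult.assoc contract_mult_iota)
  then show ?case
    by (simp add: iota contract_mult_iota involute_mult_iota algebra_simps scale_mult)
qed (simp_all add: contract.add contract.scale involute.add involute.scale distrib_right distrib_left
    scale_mult E.scale_right_distrib)

lemma linear_fold_contract: "Vector_Spaces.linear scaleE scaleE (fold contract vs)"
  by (induction vs) (simp_all add: linear_iff E.vector_space_axioms contract.add contract.scale)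

lemma alternating_fold_contract: "alternating_words scaleV scaleE (\<lambda>vs. fold contract vs x)"
proof -
  interpret f: Vector_Spaces.linear scaleE scaleE "fold contract vs" for vs
    by (rule linear_fold_contract)
  show ?thesis
    by (simp add: alternating_words_def contract_vector_add contract_vector_scale f.add f.scale)
qed

text \<open>Contraction into \<open>F\<close>: letter by letter, the first letter acts first. The value depends only on the
product of the word, because it is multilinear in the letters and contracting twice with the same vector gives \<open>0\<close> (\<open>contract_contract\<close>).\<close>

definition dual :: "'e \<Rightarrow> 'e \<Rightarrow> 'e" where
  "dual F = (SOME L. Vector_Spaces.linear scaleE scaleE L \<and>
     (\<forall>vs. L (ext_prod \<iota> vs) = fold contract vs F))"

lemma linear_dual: "Vector_Spaces.linear scaleE scaleE (dual F)"
  and dual_ext_prod: "dual F (ext_prod \<iota> vs) = fold contract vs F"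
  using someI_ex[OF exterior_lift[OF E.vector_space_axioms alternating_fold_contract]]
  unfolding dual_def by blast+

sublocale dual: Vector_Spaces.linear scaleE scaleE "dual F" for F
  by (rule linear_dual)

lemma dual_one [simp]: "dual F 1 = F"
  using dual_ext_prod[of F "[]"] by simp

text \<open>Together with \<open>dual_one\<close> this determines the operator, and these are the properties used in the duality.\<close>

lemma dual_mult_iota: "dual F (x * \<iota> v) = contract v (dual F x)"
proof (rule linear_eq_on_words[where scaleW = scaleE and x = x
      and f = "\<lambda>x. dual F (x * \<iota> v)" and f' = "\<lambda>x. contract v (dual F x)"])
  show "Vector_Spaces.linear scaleE scaleE (\<lambda>x. dual F (x * \<iota> v))"
    "Vector_Spaces.linear scaleE scaleE (\<lambda>x. contract v (dual F x))"
    by (auto simp: linear_iff E.vector_space_axioms distrib_right scale_mult contract.add contract.scale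
        dual.add dual.scale)
  show "dual F (ext_prod \<iota> vs * \<iota> v) = contract v (dual F (ext_prod \<iota> vs))" for vs
    using dual_ext_prod[of F "vs @ [v]"] by (simp add: dual_ext_prod)
qed

lemma involute_dual:
  assumes "involute F = scaleE c F"
  shows "involute (dual F (ext_prod \<iota> vs)) = scaleE (c * (- 1) ^ length vs) (dual F (ext_prod \<iota> vs))"
  by (induction vs rule: rev_induct)
     (simp_all add: assms dual_mult_iota involute_contract contract.scale)

text \<open>Taking the coproduct and contracting either factor both amount to extracting one letter of the word
with a sign. In the slice \<open>(i, j)\<close> contracting the first factor leaves \<open>i - 1\<close> letters on the left;
extracting the same letter from the second factor in the slice \<open>(i - 1, j + 1)\<close> gives the same terms, up to
the sign for passing those \<open>i - 1\<close> letters.\<close>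

lemma slice_sum_contract:
  assumes "bilinear_map scaleE scaleE sW g"
  shows "slice_sum sW \<iota> ws i j (\<lambda>x y. g (contract v x) y) =
    sW ((- 1) powi (i - 1)) (slice_sum sW \<iota> ws (i - 1) (j + 1) (\<lambda>x y. g x (contract v y)))"
  using assms
proof (induction ws arbitrary: i j g)
  case Nil
  then interpret W: vector_space sW by (auto simp: bilinear_map_def linear_iff)
  have "g (scaleE 0 1) 1 = 0" "g 1 (scaleE 0 1) = 0"
    using Nil unfolding bilinear_map_def linear_iff by (metis W.scale_zero_left)+
  then show ?case
    by (simp add: slice_sum_Nil[OF W.vector_space_axioms])
next
  case (Cons w ws)
  then have W: "vector_space sW" by (auto simp: bilinear_map_def linear_iff)
  then interpret W: vector_space sW .
  have g: "g (scaleE c x - x') y = sW c (g x y) - g x' y"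
    "g x (scaleE c y - y') = sW c (g x y) - g x y'" for c x x' y y'
  proof -
    interpret l: Vector_Spaces.linear scaleE sW "\<lambda>x. g x y" using Cons.prems by (simp add: bilinear_map_def)
    interpret r: Vector_Spaces.linear scaleE sW "g x" using Cons.prems by (simp add: bilinear_map_def)
    show "g (scaleE c x - x') y = sW c (g x y) - g x' y" by (simp add: l.diff l.scale)
    show "g x (scaleE c y - y') = sW c (g x y) - g x y'" by (simp add: r.diff r.scale)
  qed
  note IH = Cons.IH[OF bilinear_mult_left[OF Cons.prems]] Cons.IH[OF bilinear_mult_right[OF Cons.prems]]
  show ?case
    by (auto simp: slice_sum_Cons[OF W] contract_mult_iota g slice_sum_fun_diff[OF W]
        slice_sum_fun_scale[OF W] IH minus_one_powi)
qed

end

section \<open>Geometric products\<close>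

locale exterior_tensor_square =
  exterior_algebra scaleV scaleE \<iota> + tensor: tensor_product scaleE scaleE scaleT tens
  for scaleV :: "'k::field \<Rightarrow> 'v::ab_group_add \<Rightarrow> 'v"
    and scaleE :: "'k \<Rightarrow> 'e::ring_1 \<Rightarrow> 'e"
    and \<iota> :: "'v \<Rightarrow> 'e"
    and scaleT :: "'k \<Rightarrow> 't::ab_group_add \<Rightarrow> 't"
    and tens :: "'e \<Rightarrow> 'e \<Rightarrow> 't"
begin

lemma ex1_linear_on_word_tensors:
  assumes "bilinear_map scaleE scaleE scaleW \<beta>"
  shows "\<exists>!D. Vector_Spaces.linear scaleT scaleW D \<and>
     (\<forall>vs ws. D (tens (ext_prod \<iota> vs) (ext_prod \<iota> ws)) = \<beta> (ext_prod \<iota> vs) (ext_prod \<iota> ws))"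
proof (rule ex_ex1I)
  show "\<exists>D. Vector_Spaces.linear scaleT scaleW D \<and>
     (\<forall>vs ws. D (tens (ext_prod \<iota> vs) (ext_prod \<iota> ws)) = \<beta> (ext_prod \<iota> vs) (ext_prod \<iota> ws))"
    using tensor.tensor_lift[OF assms] by blast
next
  fix D D'
  assume D: "Vector_Spaces.linear scaleT scaleW D \<and>
     (\<forall>vs ws. D (tens (ext_prod \<iota> vs) (ext_prod \<iota> ws)) = \<beta> (ext_prod \<iota> vs) (ext_prod \<iota> ws))"
    and D': "Vector_Spaces.linear scaleT scaleW D' \<and>
     (\<forall>vs ws. D' (tens (ext_prod \<iota> vs) (ext_prod \<iota> ws)) = \<beta> (ext_prod \<iota> vs) (ext_prod \<iota> ws))"
  have lin: "Vector_Spaces.linear scaleE scaleW (\<lambda>x. L (tens x y))"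
     "Vector_Spaces.linear scaleE scaleW (\<lambda>y. L (tens x y))"
    if "Vector_Spaces.linear scaleT scaleW L" for L x y
    using that by (auto simp: linear_iff E.vector_space_axioms tensor.tens_add_left tensor.tens_add_right
        tensor.tens_scale_left tensor.tens_scale_right)
  \<comment> \<open>Two maps linear in each factor are compared on words one factor at a time.\<close>
  have w: "D (tens (ext_prod \<iota> vs) y) = D' (tens (ext_prod \<iota> vs) y)" for vs y
    by (rule linear_eq_on_words[where scaleW = scaleW and x = y and f = "\<lambda>y. D (tens (ext_prod \<iota> vs) y)"
          and f' = "\<lambda>y. D' (tens (ext_prod \<iota> vs) y)"])
       (use D D' lin in auto)
  have "D (tens x y) = D' (tens x y)" for x y
    by (rule linear_eq_on_words[where scaleW = scaleW and x = x and f = "\<lambda>x. D (tens x y)"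
          and f' = "\<lambda>x. D' (tens x y)"])
       (use D D' lin w in auto)
  then show "D = D'"
    using D D' by (intro tensor.linear_eq_on_tensors) auto
qed

lemma bilinear_tens_mult:
  "bilinear_map scaleE scaleE scaleT (\<lambda>x y. tens (z * x) y)"
  "bilinear_map scaleE scaleE scaleT (\<lambda>x y. tens x (y * z))"
  "Vector_Spaces.linear scaleE scaleT (\<lambda>z. tens (z * x) y)"
  "Vector_Spaces.linear scaleE scaleT (\<lambda>z. tens x (y * z))"
  by (simp_all add: bilinear_map_def linear_iff E.vector_space_axioms tensor.T.vector_space_axioms
      tensor.tens_add_left tensor.tens_add_right tensor.tens_scale_left tensor.tens_scale_right
      distrib_left distrib_right scale_mult)

text \<open>The bilinear map \<open>(X, Y) \<mapsto> \<Sum> X Y\<^sub>1 \<otimes> Y\<^sub>2\<close> over the slice of \<open>Y\<close> whose first factor has step \<open>h\<close>. This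
is the second geometric product (\<open>diamond12_tens\<close>), but with an integer \<open>h\<close>, so that the Leibniz rule below
can refer to \<open>h - 1\<close> for all \<open>h\<close>.\<close>

definition left_merge :: "int \<Rightarrow> 'e \<Rightarrow> 'e \<Rightarrow> 't" where
  "left_merge h = (SOME R. bilinear_map scaleE scaleE scaleT R \<and>
     (\<forall>X ws. R X (ext_prod \<iota> ws) =
        slice_sum scaleT \<iota> ws h (int (length ws) - h) (\<lambda>x y. tens (X * x) y)))"

lemma bilinear_left_merge: "bilinear_map scaleE scaleE scaleT (left_merge h)"
  and left_merge_ext_prod: "left_merge h X (ext_prod \<iota> ws) =
        slice_sum scaleT \<iota> ws h (int (length ws) - h) (\<lambda>x y. tens (X * x) y)"
  using someI_ex[OF slice_sum_lift_family[OF bilinear_tens_mult(1,3),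
        where i = "\<lambda>_. h" and j = "\<lambda>k. int k - h"]]
  unfolding left_merge_def by blast+

lemma linear_diamond12: "Vector_Spaces.linear scaleT scaleT (diamond12 scaleT tens \<iota> h)"
  and diamond12_tens: "diamond12 scaleT tens \<iota> h (tens X Y) = left_merge (int h) X Y"
proof -
  obtain D where D: "Vector_Spaces.linear scaleT scaleT D" "\<And>X Y. D (tens X Y) = left_merge (int h) X Y"
    using tensor.tensor_lift[OF bilinear_left_merge] by metis
  have "diamond12 scaleT tens \<iota> h = D"
    unfolding diamond12_def left_merge_ext_prod[symmetric]
    by (rule the1_equality[OF ex1_linear_on_word_tensors[OF bilinear_left_merge]]) (simp add: D)
  with D show "Vector_Spaces.linear scaleT scaleT (diamond12 scaleT tens \<iota> h)"
    "diamond12 scaleT tens \<iota> h (tens X Y) = left_merge (int h) X Y"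
    by simp_all
qed

lemma linear_diamond21: "Vector_Spaces.linear scaleT scaleT (diamond21 scaleT tens \<iota> h)"
  and diamond21_ext_prod: "diamond21 scaleT tens \<iota> h (tens (ext_prod \<iota> vs) (ext_prod \<iota> ws)) =
     slice_sum scaleT \<iota> vs (int (length vs) - int h) (int h) (\<lambda>x y. tens x (y * ext_prod \<iota> ws))"
proof -
  obtain L where L: "bilinear_map scaleE scaleE scaleT L"
    "\<And>B vs. L B (ext_prod \<iota> vs) =
       slice_sum scaleT \<iota> vs (int (length vs) - int h) (int h) (\<lambda>x y. tens x (y * B))"
    using slice_sum_lift_family[OF bilinear_tens_mult(2,4),
        where i = "\<lambda>k. int k - int h" and j = "\<lambda>_. int h"] by metis
  have "bilinear_map scaleE scaleE scaleT (\<lambda>x y. L y x)"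
    using L(1) by (simp add: bilinear_map_def)
  from theI'[OF ex1_linear_on_word_tensors[OF this]]
  show "Vector_Spaces.linear scaleT scaleT (diamond21 scaleT tens \<iota> h)"
    "diamond21 scaleT tens \<iota> h (tens (ext_prod \<iota> vs) (ext_prod \<iota> ws)) =
     slice_sum scaleT \<iota> vs (int (length vs) - int h) (int h) (\<lambda>x y. tens x (y * ext_prod \<iota> ws))"
    unfolding diamond21_def L(2) by blast+
qed

text \<open>An element annihilated by all vectors, such as a volume element, survives only multiplication by
scalars.\<close>

lemma left_merge_top:
  assumes "\<And>v. F * \<iota> v = 0"
  shows "left_merge h F Y = (if h = 0 then tens F Y else 0)"
proof (rule linear_eq_on_words[where scaleW = scaleT and x = Y
      and f = "left_merge h F" and f' = "\<lambda>Y. if h = 0 then tens F Y else 0"])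
  show "Vector_Spaces.linear scaleE scaleT (left_merge h F)"
    using bilinear_left_merge by (simp add: bilinear_map_def)
  show "Vector_Spaces.linear scaleE scaleT (\<lambda>Y. if h = 0 then tens F Y else 0)"
    by (simp add: linear_iff E.vector_space_axioms tensor.T.vector_space_axioms
      tensor.tens_add_right tensor.tens_scale_right)
  fix ws
  show "left_merge h F (ext_prod \<iota> ws) = (if h = 0 then tens F (ext_prod \<iota> ws) else 0)"
  proof (cases "h = 0")
    case True
    then show ?thesis
      using slice_sum_all_right[OF tensor.T.vector_space_axioms, of \<iota> ws "\<lambda>x y. tens (F * x) y"]
      by (simp add: left_merge_ext_prod)
  next
    case False
    have "left_merge h F (ext_prod \<iota> ws) = slice_sum scaleT \<iota> ws h (int (length ws) - h) (\<lambda>x y. 0)"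
      unfolding left_merge_ext_prod
    proof (rule slice_sum_cong)
      fix us zs :: "'v list"
      assume "int (length us) = h"
      with False obtain u us' where "us = u # us'" by (cases us) auto
      then have "F * ext_prod \<iota> us = scaleE 0 1"
        by (simp add: assms flip: mult.assoc)
      then show "tens (F * ext_prod \<iota> us) (ext_prod \<iota> zs) = 0"
        by (simp only: tensor.tens_scale_left tensor.T.scale_zero_left)
    qed
    with False show ?thesis by (simp add: slice_sum_fun_zero[OF tensor.T.vector_space_axioms])
  qed
qed

end

section \<open>Contraction intertwines the geometric products\<close>

locale exterior_tensor_square_with_form =
  exterior_tensor_square scaleV scaleE \<iota> scaleT tens + exterior_algebra_with_form scaleV scaleE \<iota> \<beta>
  for scaleV :: "'k::field \<Rightarrow> 'v::ab_group_add \<Rightarrow> 'v"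
    and scaleE :: "'k \<Rightarrow> 'e::ring_1 \<Rightarrow> 'e"
    and \<iota> :: "'v \<Rightarrow> 'e"
    and scaleT :: "'k \<Rightarrow> 't::ab_group_add \<Rightarrow> 't"
    and tens :: "'e \<Rightarrow> 'e \<Rightarrow> 't"
    and \<beta> :: "'v \<Rightarrow> 'v \<Rightarrow> 'k"
begin

abbreviation contract_left :: "'v \<Rightarrow> 't \<Rightarrow> 't" where
  "contract_left v \<equiv> tensor_map scaleT tens (contract v) (\<lambda>x. x)"

abbreviation contract_right :: "'v \<Rightarrow> 't \<Rightarrow> 't" where
  "contract_right v \<equiv> tensor_map scaleT tens (\<lambda>x. x) (contract v)"

lemma linear_ident: "Vector_Spaces.linear scaleE scaleE (\<lambda>x. x)"
  by (simp add: linear_iff E.vector_space_axioms)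

sublocale contract_left: Vector_Spaces.linear scaleT scaleT "contract_left v" for v
  by (rule linear_tensor_map[OF tensor.tensor linear_contract linear_ident])

sublocale contract_right: Vector_Spaces.linear scaleT scaleT "contract_right v" for v
  by (rule linear_tensor_map[OF tensor.tensor linear_ident linear_contract])

lemma contract_left_tens: "contract_left v (tens x y) = tens (contract v x) y"
  by (rule tensor_map_tens[OF tensor.tensor linear_contract linear_ident])

lemma contract_right_tens: "contract_right v (tens x y) = tens x (contract v y)"
  by (rule tensor_map_tens[OF tensor.tensor linear_ident linear_contract])

text \<open>The Leibniz rule for \<open>left_merge\<close>. Contracting the first factor \<open>X Y\<^sub>1\<close> gives a term with
\<open>i\<^sub>v(X)\<close> and a term with \<open>i\<^sub>v(Y\<^sub>1)\<close>; the latter is traded for a contraction of the second factor by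
\<open>slice_sum_contract\<close>.\<close>

lemma left_merge_contract:
  "left_merge h (contract v X) Y =
     contract_left v (left_merge h X Y) +
     scaleT ((- 1) powi h) (contract_right v (left_merge (h - 1) (involute X) Y))"
proof (rule linear_eq_on_words[where scaleW = scaleT and x = Y
      and f = "left_merge h (contract v X)" and
      f' = "\<lambda>Y. contract_left v (left_merge h X Y) +
     scaleT ((- 1) powi h) (contract_right v (left_merge (h - 1) (involute X) Y))"])
  have lin: "Vector_Spaces.linear scaleE scaleT (left_merge h X)" for h X
    using bilinear_left_merge by (simp add: bilinear_map_def)
  show "Vector_Spaces.linear scaleE scaleT (left_merge h (contract v X))"
    by (rule lin)
  show "Vector_Spaces.linear scaleE scaleT (\<lambda>Y. contract_left v (left_merge h X Y) +
     scaleT ((- 1) powi h) (contract_right v (left_merge (h - 1) (involute X) Y)))"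
    using lin by (simp add: linear_iff contract_left.add contract_left.scale contract_right.add
        contract_right.scale tensor.T.scale_right_distrib mult.commute)
  fix ws
  note T = tensor.T.vector_space_axioms
  let ?g = "\<lambda>x y. tens (involute X * x) y"
  have "contract_left v (left_merge h X (ext_prod \<iota> ws)) =
     slice_sum scaleT \<iota> ws h (int (length ws) - h) (\<lambda>x y. tens (contract v X * x) y) +
     slice_sum scaleT \<iota> ws h (int (length ws) - h) (\<lambda>x y. ?g (contract v x) y)"
    unfolding left_merge_ext_prod slice_sum_linear_image[OF contract_left.linear_axioms]
    by (simp add: contract_left_tens contract_mult tensor.tens_add_left slice_sum_fun_add[OF T])
  moreover have "slice_sum scaleT \<iota> ws h (int (length ws) - h) (\<lambda>x y. ?g (contract v x) y) =
     scaleT ((- 1) powi (h - 1)) (slice_sum scaleT \<iota> ws (h - 1) (int (length ws) - h + 1) (\<lambda>x y. ?g x (contract v y)))"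
    by (rule slice_sum_contract[OF bilinear_tens_mult(1)])
  moreover have "contract_right v (left_merge (h - 1) (involute X) (ext_prod \<iota> ws)) =
     slice_sum scaleT \<iota> ws (h - 1) (int (length ws) - h + 1) (\<lambda>x y. ?g x (contract v y))"
    unfolding left_merge_ext_prod slice_sum_linear_image[OF contract_right.linear_axioms]
    by (simp add: contract_right_tens algebra_simps)
  ultimately show "left_merge h (contract v X) (ext_prod \<iota> ws) =
      contract_left v (left_merge h X (ext_prod \<iota> ws)) +
      scaleT ((- 1) powi h) (contract_right v (left_merge (h - 1) (involute X) (ext_prod \<iota> ws)))"
    by (simp add: left_merge_ext_prod minus_one_powi)
qed

text \<open>The core of the duality. Having \<open>B\<close> to the left of \<open>y\<close> is essential: a letter appended to \<open>A\<close> then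
ends up at the right end of \<open>x\<close> or of \<open>B y\<close>, where \<open>dual F\<close> turns it into a contraction.\<close>

lemma slice_sum_dual:
  assumes top: "\<And>v. F * \<iota> v = 0" and inv: "involute F = scaleE ((- 1) ^ n) F"
  shows "slice_sum scaleT \<iota> vs (int (length vs) - h) h (\<lambda>x y. tens (dual F x) (dual F (B * y))) =
     scaleT ((- 1) powi (h * (int (length vs) - int n)))
       (left_merge h (dual F (ext_prod \<iota> vs)) (dual F B))"
proof (induction vs arbitrary: h rule: rev_induct)
  case Nil
  show ?case
    by (simp add: slice_sum_Nil[OF tensor.T.vector_space_axioms] left_merge_top[OF top])
next
  case (snoc v vs)
  let ?S = "\<lambda>h. slice_sum scaleT \<iota> vs (int (length vs) - h) h (\<lambda>x y. tens (dual F x) (dual F (B * y)))"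
  let ?X = "dual F (ext_prod \<iota> vs)" and ?Y = "dual F B"
  have right: "slice_sum scaleT \<iota> vs (int (length vs) - (h - 1)) (h - 1)
      (\<lambda>x y. tens (dual F x) (dual F (B * (y * \<iota> v)))) = contract_right v (?S (h - 1))"
    by (simp add: slice_sum_linear_image[OF contract_right.linear_axioms] contract_right_tens
        dual_mult_iota flip: mult.assoc)
  have left: "slice_sum scaleT \<iota> vs (int (length vs) - h) h
      (\<lambda>x y. tens (dual F (x * \<iota> v)) (dual F (B * y))) = contract_left v (?S h)"
    by (simp add: slice_sum_linear_image[OF contract_left.linear_axioms] contract_left_tens
        dual_mult_iota)
  have "slice_sum scaleT \<iota> (vs @ [v]) (int (length (vs @ [v])) - h) h
      (\<lambda>x y. tens (dual F x) (dual F (B * y))) =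
    contract_right v (?S (h - 1)) + scaleT ((- 1) powi h) (contract_left v (?S h))"
    unfolding slice_sum_snoc[OF tensor.T.vector_space_axioms] right[symmetric] left[symmetric]
    by (simp add: algebra_simps)
  also have "\<dots> = scaleT ((- 1) powi ((h - 1) * (int (length vs) - int n)))
        (contract_right v (left_merge (h - 1) ?X ?Y)) +
      scaleT ((- 1) powi h * (- 1) powi (h * (int (length vs) - int n)))
        (contract_left v (left_merge h ?X ?Y))"
    by (simp only: snoc contract_left.scale contract_right.scale tensor.T.scale_scale)
  also have "\<dots> = scaleT ((- 1) powi (h * (int (length (vs @ [v])) - int n)))
       (left_merge h (contract v ?X) ?Y)"
  proof -
    \<comment> \<open>The Leibniz rule involves \<open>involute ?X\<close>, which is \<open>?X\<close> with the sign of \<open>n + length vs\<close>.\<close>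
    have "left_merge (h - 1) (scaleE c ?X) ?Y = scaleT c (left_merge (h - 1) ?X ?Y)" for c
      using bilinear_left_merge by (simp add: bilinear_map_def linear_iff)
    then show ?thesis
      by (auto simp: left_merge_contract involute_dual[OF inv] minus_one_powi minus_one_power_iff
        contract_right.scale contract_right.neg tensor.T.scale_right_distrib)
  qed
  finally show ?case
    by (simp add: dual_mult_iota)
qed

text \<open>The remaining sign \<open>(-1)\<^sup>h\<^sup>b\<close> comes from moving the step-\<open>h\<close> factor of \<open>A\<close> past \<open>B\<close>.\<close>

lemma dual_diamond:
  assumes top: "\<And>v. F * \<iota> v = 0" and inv: "involute F = scaleE ((- 1) ^ n) F"
  defines "star \<equiv> dual F"
  shows "tensor_map scaleT tens star star
      (diamond21 scaleT tens \<iota> h (tens (ext_prod \<iota> vs) (ext_prod \<iota> ws))) =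
    scaleT ((- 1) powi (int h * (int (length vs) + int (length ws) - int n)))
      (diamond12 scaleT tens \<iota> h
        (tensor_map scaleT tens star star (tens (ext_prod \<iota> vs) (ext_prod \<iota> ws))))"
proof -
  note star = linear_tensor_map[OF tensor.tensor linear_dual linear_dual, of F F, folded star_def]
    tensor_map_tens[OF tensor.tensor linear_dual linear_dual, of F F, folded star_def]
  note T = tensor.T.vector_space_axioms
  let ?A = "ext_prod \<iota> vs" and ?B = "ext_prod \<iota> ws"
  have "tensor_map scaleT tens star star (diamond21 scaleT tens \<iota> h (tens ?A ?B)) =
     slice_sum scaleT \<iota> vs (int (length vs) - int h) (int h) (\<lambda>x y. tens (star x) (star (y * ?B)))"
    by (simp add: diamond21_ext_prod slice_sum_linear_image[OF star(1)] star(2))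
  also have "\<dots> = slice_sum scaleT \<iota> vs (int (length vs) - int h) (int h)
      (\<lambda>x y. scaleT ((- 1) ^ (h * length ws)) (tens (star x) (star (?B * y))))"
    by (rule slice_sum_cong)
       (auto simp: ext_prod_swap[of _ ws] star_def dual.scale tensor.tens_scale_right)
  also have "\<dots> = scaleT ((- 1) ^ (h * length ws) * (- 1) powi (int h * (int (length vs) - int n)))
       (left_merge (int h) (star ?A) (star ?B))"
    by (simp add: slice_sum_fun_scale[OF T] slice_sum_dual[OF top inv] star_def)
  also have "(- 1) ^ (h * length ws) * (- 1) powi (int h * (int (length vs) - int n)) =
      ((- 1) powi (int h * (int (length vs) + int (length ws) - int n)) :: 'k)"
    by (auto simp: minus_one_powi minus_one_power_iff)
  finally show ?thesis
    by (simp add: star(2) diamond12_tens)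
qed

end

section \<open>The Hodge star as contraction of the volume element\<close>

context exterior_algebra_with_form
begin

lemma contract_orthogonal:
  assumes "\<And>w. w \<in> set ws \<Longrightarrow> \<beta> v w = 0"
  shows "contract v (ext_prod \<iota> ws) = 0"
  using assms by (induction ws) (simp_all add: contract_mult_iota)

text \<open>Each contraction strips off the leading letter and ignores the others, which are orthogonal to it.\<close>

lemma fold_contract_orthonormal:
  assumes "\<And>v w. v \<in> set (xs @ ys) \<Longrightarrow> w \<in> set (xs @ ys) \<Longrightarrow> \<beta> v w = (if v = w then 1 else 0)"
    and "distinct (xs @ ys)"
  shows "fold contract xs (ext_prod \<iota> (xs @ ys)) = ext_prod \<iota> ys"
  using assms
proof (induction xs)
  case (Cons x xs)
  have "contract x (ext_prod \<iota> (xs @ ys)) = 0"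
    by (rule contract_orthogonal) (use Cons.prems in \<open>auto split: if_splits\<close>)
  then have "contract x (ext_prod \<iota> ((x # xs) @ ys)) = ext_prod \<iota> (xs @ ys)"
    using Cons.prems(1)[of x x] by (simp add: contract_mult_iota)
  moreover have "fold contract xs (ext_prod \<iota> (xs @ ys)) = ext_prod \<iota> ys"
    by (rule Cons.IH) (use Cons.prems in auto)
  ultimately show ?case by simp
qed simp

end

context exterior_algebra
begin

text \<open>The span of the products \<open>f\<^sub>I\<close> contains every word in basis vectors: sort the word, or find a repeated
letter. Hence it is stable under left multiplication by basis vectors, and so by all vectors.\<close>

lemma span_basis_products:
  assumes basis: "is_ordered_basis scaleV fs"
  shows "E.span ((\<lambda>I. ext_prod \<iota> (nths fs I)) ` Pow {..<length fs}) = UNIV" (is "?S = _")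
proof -
  have V: "V.span (set fs) = UNIV" and dist: "distinct fs"
    using basis by (auto simp: is_ordered_basis_def)
  have word: "ext_prod \<iota> xs \<in> ?S" if "set xs \<subseteq> set fs" for xs
  proof (cases "distinct xs")
    case True
    define I where "I = {i. i < length fs \<and> fs ! i \<in> set xs}"
    have "set (nths fs I) = set xs"
      using that by (auto simp: set_nths I_def in_set_conv_nth) (metis in_set_conv_nth subsetD)
    then have "mset xs = mset (nths fs I)"
      using True dist by (simp add: set_eq_iff_mset_eq_distinct)
    from ext_prod_permute[OF this] obtain \<epsilon> where "ext_prod \<iota> xs = scaleE \<epsilon> (ext_prod \<iota> (nths fs I))"
      by blast
    moreover have "I \<in> Pow {..<length fs}" by (auto simp: I_def)
    ultimately show ?thesis by (metis E.span_scale E.span_base imageI)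
  qed (simp add: ext_prod_not_distinct E.span_zero)
  have gen: "\<iota> f * x \<in> ?S" if "f \<in> set fs" "x \<in> ?S" for f x
  proof -
    have "E.subspace {x. \<iota> f * x \<in> ?S}"
      by (rule E.subspaceI) (auto simp: E.span_zero distrib_left scale_mult intro: E.span_add E.span_scale)
    moreover have "(\<lambda>I. ext_prod \<iota> (nths fs I)) ` Pow {..<length fs} \<subseteq> {x. \<iota> f * x \<in> ?S}"
    proof (intro subsetI CollectI, elim imageE)
      fix x I
      assume "x = ext_prod \<iota> (nths fs I)"
      then show "\<iota> f * x \<in> ?S"
        using word[of "f # nths fs I"] that(1) set_nths_subset[of fs I] by simp
    qed
    ultimately show ?thesis using E.span_minimal that(2) by blast
  qed
  have step: "\<iota> v * x \<in> ?S" if "x \<in> ?S" for v x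
  proof -
    have "V.subspace {v. \<iota> v * x \<in> ?S}"
    proof (rule V.subspaceI)
      show "0 \<in> {v. \<iota> v * x \<in> ?S}" by (simp add: E.span_zero iota_zero)
    qed (auto simp: distrib_right iota_add iota_scale scale_mult intro: E.span_add E.span_scale)
    moreover have "set fs \<subseteq> {v. \<iota> v * x \<in> ?S}" using gen that by blast
    ultimately show ?thesis using V.span_minimal V by blast
  qed
  have "x \<in> ?S" for x
  proof (induction x rule: exterior_induct)
    case one
    then show ?case using word[of "[]"] by simp
  qed (auto intro: E.span_add E.span_scale step)
  then show ?thesis by blast
qed

text \<open>There are no elements of step \<open>n + 1\<close>.\<close>

lemma ext_prod_basis_mult_iota:
  assumes basis: "is_ordered_basis scaleV fs"
  shows "ext_prod \<iota> fs * \<iota> v = 0"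
proof -
  have V: "V.span (set fs) = UNIV" using basis by (simp add: is_ordered_basis_def)
  have "V.subspace {v. ext_prod \<iota> fs * \<iota> v = 0}"
  proof (rule V.subspaceI)
    show "0 \<in> {v. ext_prod \<iota> fs * \<iota> v = 0}" by (simp add: iota_zero)
  qed (auto simp: distrib_left iota_add iota_scale scale_mult)
  moreover have "ext_prod \<iota> fs * \<iota> f = 0" if "f \<in> set fs" for f
    using ext_prod_not_distinct[of "fs @ [f]"] that by simp
  ultimately show ?thesis using V.span_minimal[of "set fs" "{v. ext_prod \<iota> fs * \<iota> v = 0}"] V by blast
qed

end

lemma ex_orthonormal_form:
  assumes "vector_space scaleV" "is_ordered_basis scaleV fs"
  shows "\<exists>\<beta>. bilinear_map scaleV scaleV (*) \<beta> \<and>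
     (\<forall>v\<in>set fs. \<forall>w\<in>set fs. \<beta> v w = (if v = w then 1 else 0))"
proof -
  interpret V: vector_space scaleV by fact
  have V: "V.span (set fs) = UNIV" "V.independent (set fs)"
    using assms(2) by (auto simp: is_ordered_basis_def)
  define c where "c = V.representation (set fs)"
  define \<beta> where "\<beta> v w = (\<Sum>f\<in>set fs. c v f * c w f)" for v w
  have c: "c (v + w) f = c v f + c w f" "c (scaleV a v) f = a * c v f" for v w a f
    using V.representation_add[OF V(2)] V.representation_scale[OF V(2)] V(1) by (auto simp: c_def)
  have "bilinear_map scaleV scaleV (*) \<beta>"
    by (simp add: bilinear_map_def linear_iff V.vector_space_axioms vector_space_mult \<beta>_def c algebra_simps sum.distrib
        sum_distrib_left)
  moreover have "\<beta> v w = (if v = w then 1 else 0)" if "v \<in> set fs" "w \<in> set fs" for v w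
  proof -
    have "c v f = (if f = v then 1 else 0)" "c w f = (if f = w then 1 else 0)" for f
      using V.representation_basis[OF V(2)] that by (auto simp: c_def)
    then have "\<beta> v w = (\<Sum>f\<in>set fs. if f = v then if v = w then 1 else 0 else 0)"
      unfolding \<beta>_def by (intro sum.cong) auto
    then show ?thesis using that by simp
  qed
  ultimately show ?thesis by blast
qed

text \<open>Write \<open>F = \<epsilon> f\<^sub>I f\<^sub>J\<close> with \<open>J\<close> the complement of \<open>I\<close>; contracting with the letters of
\<open>f\<^sub>I\<close> leaves \<open>\<epsilon> f\<^sub>J\<close>, the value that
defines the star on \<open>f\<^sub>I\<close>. The description of the star is unambiguous because \<open>F \<noteq> 0\<close> fixes each sign in the
field and the \<open>f\<^sub>I\<close> span.\<close>

lemma (in exterior_algebra_with_form) hodge_star_eq_dual: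
  assumes basis: "is_ordered_basis scaleV fs"
    and orth: "\<forall>v\<in>set fs. \<forall>w\<in>set fs. \<beta> v w = (if v = w then 1 else 0)"
  shows "hodge_star scaleE \<iota> fs = dual (ext_prod \<iota> fs)"
proof -
  let ?F = "ext_prod \<iota> fs"
  let ?p = "\<lambda>I. ext_prod \<iota> (nths fs I)" and ?q = "\<lambda>I. ext_prod \<iota> (nths fs ({..<length fs} - I))"
  have dist: "distinct fs" using basis by (simp add: is_ordered_basis_def)
  have F: "?F \<noteq> 0"
  proof
    interpret f: Vector_Spaces.linear scaleE scaleE "fold contract fs"
      by (rule linear_fold_contract)
    assume "?F = 0"
    then show False
      using fold_contract_orthonormal[of fs "[]"] orth dist one_neq_zero f.zero by simp
  qed
  have dual: "\<exists>\<epsilon>\<in>{1, - 1}. ?F = scaleE \<epsilon> (?p I * ?q I) \<and> dual ?F (?p I) = scaleE \<epsilon> (?q I)"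
    if "I \<subseteq> {..<length fs}" for I
  proof -
    let ?xs = "nths fs I" and ?ys = "nths fs ({..<length fs} - I)"
    interpret f: Vector_Spaces.linear scaleE scaleE "fold contract ?xs"
      by (rule linear_fold_contract)
    have d: "distinct (?xs @ ?ys)"
      using dist by (auto simp: set_nths nth_eq_iff_index_eq)
    have s: "set (?xs @ ?ys) = set fs"
      by (auto simp: set_nths in_set_conv_nth) blast
    have "mset fs = mset (?xs @ ?ys)"
      using d s dist by (metis set_eq_iff_mset_eq_distinct)
    from ext_prod_permute[OF this] obtain \<epsilon> where
      e: "\<epsilon> \<in> {1, - 1}" "?F = scaleE \<epsilon> (ext_prod \<iota> (?xs @ ?ys))"
      by blast
    have "fold contract ?xs (ext_prod \<iota> (?xs @ ?ys)) = ext_prod \<iota> ?ys"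
      by (rule fold_contract_orthonormal) (use orth s d in blast)+
    then have "dual ?F (?p I) = scaleE \<epsilon> (?q I)"
      by (simp add: dual_ext_prod e(2) f.scale)
    with e show ?thesis by auto
  qed
  show ?thesis
    unfolding hodge_star_def
  proof (rule the_equality)
    show "Vector_Spaces.linear scaleE scaleE (dual ?F) \<and>
      (\<forall>I\<subseteq>{..<length fs}. \<exists>\<epsilon>\<in>{1, - 1}. ?F = scaleE \<epsilon> (?p I * ?q I) \<and> dual ?F (?p I) = scaleE \<epsilon> (?q I))"
      using linear_dual dual by blast
  next
    fix L
    assume L: "Vector_Spaces.linear scaleE scaleE L \<and>
      (\<forall>I\<subseteq>{..<length fs}. \<exists>\<epsilon>\<in>{1, - 1}. ?F = scaleE \<epsilon> (?p I * ?q I) \<and> L (?p I) = scaleE \<epsilon> (?q I))"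
    interpret L: Vector_Spaces.linear scaleE scaleE L using L by blast
    have agree: "L (?p I) = dual ?F (?p I)" if I: "I \<subseteq> {..<length fs}" for I
    proof -
      obtain \<epsilon> where e: "?F = scaleE \<epsilon> (?p I * ?q I)" "L (?p I) = scaleE \<epsilon> (?q I)"
        using L I by blast
      obtain \<delta> where d: "?F = scaleE \<delta> (?p I * ?q I)" "dual ?F (?p I) = scaleE \<delta> (?q I)"
        using dual[OF I] by blast
      have "scaleE \<epsilon> (?p I * ?q I) = scaleE \<delta> (?p I * ?q I)" "?p I * ?q I \<noteq> 0"
        using e(1) d(1) F by auto
      then have "\<epsilon> = \<delta>" by (simp only: E.scale_right_imp_eq)
      with e(2) d(2) show ?thesis by simp
    qed
    have "E.subspace {x. L x = dual ?F x}"
      by (rule E.subspaceI) (simp_all add: L.add L.scale dual.add dual.scale)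
    moreover have "?p ` Pow {..<length fs} \<subseteq> {x. L x = dual ?F x}" using agree by auto
    ultimately have "E.span (?p ` Pow {..<length fs}) \<subseteq> {x. L x = dual ?F x}"
      using E.span_minimal by blast
    then show "L = dual ?F"
      unfolding span_basis_products[OF basis] by auto
  qed
qed

section \<open>The duality of the geometric products\<close>

lemma extensor_scaled_word:
  assumes "vector_space sE" "is_extensor sE \<iota> k A"
  shows "\<exists>c vs. length vs = k \<and> A = sE c (ext_prod \<iota> vs)"
proof (cases "k = 0")
  case True
  then show ?thesis using assms by (auto simp: is_extensor_def)
next
  case False
  interpret vector_space sE by fact
  show ?thesis using assms False by (auto simp: is_extensor_def) (metis scale_one)
qed

theorem theorem1:
  fixes scaleV :: "'k::field \<Rightarrow> 'v::ab_group_add \<Rightarrow> 'v"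
    and scaleE :: "'k \<Rightarrow> 'e::ring_1 \<Rightarrow> 'e"
    and scaleT :: "'k \<Rightarrow> 't::ab_group_add \<Rightarrow> 't"
    and \<iota> :: "'v \<Rightarrow> 'e"
    and tens :: "'e \<Rightarrow> 'e \<Rightarrow> 't"
    and fs :: "'v list"
    and n a b h :: nat
    and A B :: 'e
  assumes "vector_space scaleV"
    and "is_ordered_basis scaleV fs" and "length fs = n"
    and "is_exterior_algebra scaleV scaleE \<iota>"
    and "is_tensor_product scaleE scaleE scaleT tens"
    and "is_extensor scaleE \<iota> a A" and "is_extensor scaleE \<iota> b B"
    and "h > 0"
  defines "star \<equiv> hodge_star scaleE \<iota> fs"
  shows "tensor_map scaleT tens star star (diamond21 scaleT tens \<iota> h (tens A B)) =
         scaleT ((- 1) powi (int h * (int a + int b - int n)))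
           (diamond12 scaleT tens \<iota> h (tensor_map scaleT tens star star (tens A B)))"
proof -
  obtain \<beta> where \<beta>: "bilinear_map scaleV scaleV (*) \<beta>"
    "\<forall>v\<in>set fs. \<forall>w\<in>set fs. \<beta> v w = (if v = w then 1 else 0)"
    using ex_orthonormal_form[OF assms(1,2)] by blast
  interpret exterior_tensor_square_with_form scaleV scaleE \<iota> scaleT tens \<beta>
    by unfold_locales (fact assms \<beta>)+
  let ?F = "ext_prod \<iota> fs"
  have star: "star = dual ?F"
    unfolding star_def by (rule hodge_star_eq_dual[OF assms(2) \<beta>(2)])
  have inv: "involute ?F = scaleE ((- 1) ^ n) ?F"
    using assms(3) by (simp add: involute_ext_prod)
  obtain c vs where A: "length vs = a" "A = scaleE c (ext_prod \<iota> vs)"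
    using extensor_scaled_word[OF E.vector_space_axioms assms(6)] by blast
  obtain d ws where B: "length ws = b" "B = scaleE d (ext_prod \<iota> ws)"
    using extensor_scaled_word[OF E.vector_space_axioms assms(7)] by blast
  interpret ss: Vector_Spaces.linear scaleT scaleT "tensor_map scaleT tens star star"
    unfolding star by (rule linear_tensor_map[OF tensor.tensor linear_dual linear_dual])
  interpret d21: Vector_Spaces.linear scaleT scaleT "diamond21 scaleT tens \<iota> h"
    by (rule linear_diamond21)
  interpret d12: Vector_Spaces.linear scaleT scaleT "diamond12 scaleT tens \<iota> h"
    by (rule linear_diamond12)
  have "tens A B = scaleT (c * d) (tens (ext_prod \<iota> vs) (ext_prod \<iota> ws))"
    by (simp add: A B tensor.tens_scale_left tensor.tens_scale_right)
  moreover note dual_diamond[OF ext_prod_basis_mult_iota[OF assms(2)] inv, of h vs ws, folded star]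
  ultimately show ?thesis
    by (simp add: ss.scale d21.scale d12.scale A B mult.commute)
qed

end
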